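(* Let $X$ be a complex space of dimension $n$, $X^o\subset X_{\rm reg}$ a Zariski open subset and $(E,h)$ a holomorphic vector bundle on $X^o$ with a possibly singular hermitian metric. For a hermitian metric $ds^2$ on $X^o$ let $$S_X(E,h):={\rm Ker}\left(\mathscr{D}^{n,0}_{X,ds^2}(E,h)\stackrel{\bar\partial}{\to}\mathscr{D}^{n,1}_{X,ds^2}(E,h)\right).$$ Then $S_X(E,h)$ is independent of the choice of the hermitian metric $ds^2$ on $X^o$.
   Context: Conventions: all complex spaces are separated, irreducible, reduced, paracompact and countable at infinity. A Zariski open subset is the complement of a closed analytic subset. A (possibly singular) hermitian metric is $h=e^{-\varphi}h_0$ with $h_0$ a smooth hermitian metric and $\varphi$ a quasi-psh function (locally smooth plus psh). For a hermitian metric $ds^2$ on $X^o$, $\mathscr{D}^{p,q}_{X,ds^2}(E,h)$ is the sheaf on $X$ whose sections over an open $U\subset X$ are the measurable $E$-valued $(p,q)$-forms $\alpha$ on $U\cap X^o$ such that $\alpha$ and $\bar\partial\alpha$ (in the sense of distributions) are square integrable with respect to $ds^2$ and $h$ on $V_x\cap X^o$ for some neighborhood $V_x$ of every point $x\in U$. *)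

theory Defs
  imports
    "HOL-Analysis.Analysis"
    "Jordan_Normal_Form.Gauss_Jordan_Elimination"
    "Jordan_Normal_Form.Determinant"
begin

section \<open>Holomorphic, smooth and plurisubharmonic functions on open subsets of complex n-space\<close>

text \<open>
  Since local embedding dimensions of a complex space are unbounded in general, and since
  \<open>n = 0\<close> is allowed, the points of complex \<open>n\<close>-space are functions on \<open>{..<n}\<close>
  (extended by \<open>undefined\<close>, as in \<^const>\<open>PiE\<close>) rather than elements of a type indexed by \<open>n\<close>.
\<close>

definition Cn :: "nat \<Rightarrow> (nat \<Rightarrow> complex) topology" where
  "Cn n = product_topology (\<lambda>_. euclidean) {..<n}"

definition lborel_Cn :: "nat \<Rightarrow> (nat \<Rightarrow> complex) measure" where
  "lborel_Cn n = PiM {..<n} (\<lambda>_. lborel)"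

definition lebesgue_Cn :: "nat \<Rightarrow> (nat \<Rightarrow> complex) measure" where
  "lebesgue_Cn n = completion (lborel_Cn n)"

definition cpartial :: "nat \<Rightarrow> ((nat \<Rightarrow> complex) \<Rightarrow> complex) \<Rightarrow> (nat \<Rightarrow> complex) \<Rightarrow> complex" where
  "cpartial j f z = deriv (\<lambda>t. f (z(j := t))) (z j)"

definition holomorphic_Cn ::
    "nat \<Rightarrow> (nat \<Rightarrow> complex) set \<Rightarrow> ((nat \<Rightarrow> complex) \<Rightarrow> complex) \<Rightarrow> bool" where
  "holomorphic_Cn n D f \<longleftrightarrow> openin (Cn n) D \<and>
     continuous_map (subtopology (Cn n) D) euclidean f \<and>
     (\<forall>z\<in>D. \<forall>j<n. (\<lambda>t. f (z(j := t))) field_differentiable (at (z j)))"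

text \<open>Real directional derivative in direction \<open>u\<close> of the \<open>j\<close>-th coordinate: \<open>u = 1\<close> gives
  the derivative in \<open>x\<^sub>j\<close> and \<open>u = \<i>\<close> the one in \<open>y\<^sub>j\<close>.\<close>

definition rpartial ::
    "complex \<Rightarrow> nat \<Rightarrow> ((nat \<Rightarrow> complex) \<Rightarrow> complex) \<Rightarrow> (nat \<Rightarrow> complex) \<Rightarrow> complex" where
  "rpartial u j f z = vector_derivative (\<lambda>t. f (z(j := z j + complex_of_real t * u))) (at 0)"

definition dbar_partial ::
    "nat \<Rightarrow> ((nat \<Rightarrow> complex) \<Rightarrow> complex) \<Rightarrow> (nat \<Rightarrow> complex) \<Rightarrow> complex" where
  "dbar_partial j f z = (rpartial 1 j f z + \<i> * rpartial \<i> j f z) / 2"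

primrec Ck_Cn ::
    "nat \<Rightarrow> nat \<Rightarrow> (nat \<Rightarrow> complex) set \<Rightarrow> ((nat \<Rightarrow> complex) \<Rightarrow> complex) \<Rightarrow> bool" where
  "Ck_Cn 0 n D f \<longleftrightarrow> continuous_map (subtopology (Cn n) D) euclidean f"
| "Ck_Cn (Suc k) n D f \<longleftrightarrow> continuous_map (subtopology (Cn n) D) euclidean f \<and>
     (\<forall>j<n. \<forall>u\<in>{1, \<i>}.
        (\<forall>z\<in>D. (\<lambda>t. f (z(j := z j + complex_of_real t * u))) differentiable (at 0)) \<and>
        Ck_Cn k n D (rpartial u j f))"

definition smooth_Cn ::
    "nat \<Rightarrow> (nat \<Rightarrow> complex) set \<Rightarrow> ((nat \<Rightarrow> complex) \<Rightarrow> complex) \<Rightarrow> bool" where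
  "smooth_Cn n D f \<longleftrightarrow> openin (Cn n) D \<and> (\<forall>k. Ck_Cn k n D f)"

definition test_function ::
    "nat \<Rightarrow> (nat \<Rightarrow> complex) set \<Rightarrow> ((nat \<Rightarrow> complex) \<Rightarrow> complex) \<Rightarrow> bool" where
  "test_function n D \<psi> \<longleftrightarrow> smooth_Cn n (topspace (Cn n)) \<psi> \<and>
     (\<exists>K. compactin (Cn n) K \<and> K \<subseteq> D \<and> (\<forall>z\<in>topspace (Cn n) - K. \<psi> z = 0))"

definition locally_integrable_Cn ::
    "nat \<Rightarrow> (nat \<Rightarrow> complex) set \<Rightarrow> ((nat \<Rightarrow> complex) \<Rightarrow> complex) \<Rightarrow> bool" where
  "locally_integrable_Cn n D f \<longleftrightarrow>
     (\<forall>K. compactin (Cn n) K \<and> K \<subseteq> D \<longrightarrow> set_integrable (lebesgue_Cn n) K f)"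

definition line_Cn ::
    "nat \<Rightarrow> (nat \<Rightarrow> complex) \<Rightarrow> (nat \<Rightarrow> complex) \<Rightarrow> complex \<Rightarrow> nat \<Rightarrow> complex" where
  "line_Cn n z b t = (\<lambda>j\<in>{..<n}. z j + t * b j)"

text \<open>
  The third condition is the sub-mean value inequality on closed discs contained in \<open>D\<close>.  As
  \<open>u\<close> is bounded above on such a disc but may take the value \<open>-\<infinity>\<close>, it is stated for the
  nonnegative function \<open>C - u\<close>, where \<open>C\<close> is any upper bound of \<open>u\<close> on the disc.
\<close>

definition psh_Cn ::
    "nat \<Rightarrow> (nat \<Rightarrow> complex) set \<Rightarrow> ((nat \<Rightarrow> complex) \<Rightarrow> ereal) \<Rightarrow> bool" where
  "psh_Cn n D u \<longleftrightarrow> openin (Cn n) D \<and>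
     (\<forall>z\<in>D. u z \<noteq> \<infinity>) \<and>
     (\<forall>a. openin (Cn n) {z\<in>D. u z < a}) \<and>
     (\<forall>z\<in>D. \<forall>b\<in>topspace (Cn n). line_Cn n z b ` cball 0 1 \<subseteq> D \<longrightarrow>
        (\<forall>C::real. (\<forall>t\<in>cball 0 1. u (line_Cn n z b t) \<le> ereal C) \<longrightarrow>
           (\<integral>\<^sup>+\<theta>\<in>{0..2 * pi}. e2ennreal (ereal C - u (line_Cn n z b (cis \<theta>))) \<partial>lborel)
             \<le> e2ennreal (ereal (2 * pi) * (ereal C - u z)))) \<and>
     (\<forall>K\<in>connected_components_of (subtopology (Cn n) D). \<exists>z\<in>K. u z \<noteq> -\<infinity>)"

section \<open>Reduced complex spaces\<close>

text \<open>
  A reduced complex space is a topological space with a sheaf of complex-valued functions.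
  Functions are total in HOL, so \<open>f \<in> str_sheaf X U\<close> means that the restriction of \<open>f\<close> to the
  open set \<open>U\<close> is a section; the values outside \<open>U\<close> are irrelevant.
\<close>

record 'a complex_space =
  top_of :: "'a topology"
  str_sheaf :: "'a set \<Rightarrow> ('a \<Rightarrow> complex) set"

type_synonym 'a chart = "'a set \<times> ('a \<Rightarrow> nat \<Rightarrow> complex)"

abbreviation chart_inv :: "'a chart \<Rightarrow> (nat \<Rightarrow> complex) \<Rightarrow> 'a" where
  "chart_inv c \<equiv> inv_into (fst c) (snd c)"

abbreviation chart_image :: "'a chart \<Rightarrow> (nat \<Rightarrow> complex) set" where
  "chart_image c \<equiv> snd c ` fst c"

text \<open>An isomorphism of the open set \<open>U\<close> of \<open>X\<close> onto the subset \<open>A\<close> of complex \<open>N\<close>-space, where the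
  sections over \<open>A\<close> are the functions that locally are restrictions of holomorphic functions.\<close>

definition model_chart ::
    "'a complex_space \<Rightarrow> nat \<Rightarrow> (nat \<Rightarrow> complex) set \<Rightarrow> 'a chart \<Rightarrow> bool" where
  "model_chart X N A c \<longleftrightarrow> (case c of (U, \<phi>) \<Rightarrow>
     openin (top_of X) U \<and> A \<subseteq> topspace (Cn N) \<and>
     homeomorphic_map (subtopology (top_of X) U) (subtopology (Cn N) A) \<phi> \<and>
     (\<forall>V f. openin (top_of X) V \<and> V \<subseteq> U \<longrightarrow>
        (f \<in> str_sheaf X V \<longleftrightarrow>
           (\<forall>x\<in>V. \<exists>W g. holomorphic_Cn N W g \<and> \<phi> x \<in> W \<and> (\<forall>y\<in>V. \<phi> y \<in> W \<longrightarrow> f y = g (\<phi> y))))))"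

definition local_model :: "nat \<Rightarrow> (nat \<Rightarrow> complex) set \<Rightarrow> bool" where
  "local_model N A \<longleftrightarrow> (\<exists>D F. openin (Cn N) D \<and> finite F \<and> (\<forall>f\<in>F. holomorphic_Cn N D f) \<and>
     A = {z\<in>D. \<forall>f\<in>F. f z = 0})"

definition reduced_complex_space :: "'a complex_space \<Rightarrow> bool" where
  "reduced_complex_space X \<longleftrightarrow> Hausdorff_space (top_of X) \<and>
     (\<forall>U V f. openin (top_of X) U \<and> openin (top_of X) V \<and> V \<subseteq> U \<and> f \<in> str_sheaf X U
        \<longrightarrow> f \<in> str_sheaf X V) \<and>
     (\<forall>U f. openin (top_of X) U \<and>
        (\<forall>x\<in>U. \<exists>V. openin (top_of X) V \<and> x \<in> V \<and> V \<subseteq> U \<and> f \<in> str_sheaf X V)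
        \<longrightarrow> f \<in> str_sheaf X U) \<and>
     (\<forall>x\<in>topspace (top_of X). \<exists>N A c. local_model N A \<and> model_chart X N A c \<and> x \<in> fst c)"

definition analytic_subset :: "'a complex_space \<Rightarrow> 'a set \<Rightarrow> bool" where
  "analytic_subset X A \<longleftrightarrow> A \<subseteq> topspace (top_of X) \<and>
     (\<forall>x\<in>topspace (top_of X). \<exists>W F. openin (top_of X) W \<and> x \<in> W \<and> finite F \<and> F \<subseteq> str_sheaf X W \<and>
        A \<inter> W = {y\<in>W. \<forall>f\<in>F. f y = 0})"

definition Zariski_open :: "'a complex_space \<Rightarrow> 'a set \<Rightarrow> bool" where
  "Zariski_open X W \<longleftrightarrow> W \<subseteq> topspace (top_of X) \<and> analytic_subset X (topspace (top_of X) - W)"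

definition irreducible_space :: "'a complex_space \<Rightarrow> bool" where
  "irreducible_space X \<longleftrightarrow> topspace (top_of X) \<noteq> {} \<and>
     (\<forall>A B. analytic_subset X A \<and> analytic_subset X B \<and> A \<union> B = topspace (top_of X) \<longrightarrow>
        A = topspace (top_of X) \<or> B = topspace (top_of X))"

definition paracompact_space :: "'a topology \<Rightarrow> bool" where
  "paracompact_space T \<longleftrightarrow>
     (\<forall>\<U>. (\<forall>U\<in>\<U>. openin T U) \<and> \<Union>\<U> = topspace T \<longrightarrow>
        (\<exists>\<V>. (\<forall>V\<in>\<V>. openin T V \<and> (\<exists>U\<in>\<U>. V \<subseteq> U)) \<and> \<Union>\<V> = topspace T \<and> locally_finite_in T \<V>))"

definition countable_at_infinity :: "'a topology \<Rightarrow> bool" where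
  "countable_at_infinity T \<longleftrightarrow>
     (\<exists>K::nat \<Rightarrow> 'a set. (\<forall>i. compactin T (K i)) \<and> (\<Union>i. K i) = topspace T)"

definition coord_chart :: "'a complex_space \<Rightarrow> nat \<Rightarrow> 'a chart \<Rightarrow> bool" where
  "coord_chart X n c \<longleftrightarrow> openin (Cn n) (chart_image c) \<and> model_chart X n (chart_image c) c"

definition reg_dim :: "'a complex_space \<Rightarrow> nat \<Rightarrow> 'a set" where
  "reg_dim X d = {x. \<exists>c. coord_chart X d c \<and> x \<in> fst c}"

definition reg :: "'a complex_space \<Rightarrow> 'a set" where
  "reg X = (\<Union>d. reg_dim X d)"

text \<open>The dimension is the maximal dimension of the manifold of regular points
  (for irreducible \<open>X\<close> all components of that manifold have the same dimension).\<close>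

definition has_dim :: "'a complex_space \<Rightarrow> nat \<Rightarrow> bool" where
  "has_dim X n \<longleftrightarrow> reg_dim X n \<noteq> {} \<and> (\<forall>d. reg_dim X d \<noteq> {} \<longrightarrow> d \<le> n)"

definition charts :: "'a complex_space \<Rightarrow> nat \<Rightarrow> 'a set \<Rightarrow> 'a chart set" where
  "charts X n W = {c. coord_chart X n c \<and> fst c \<subseteq> W}"

text \<open>The Jacobian entry \<open>\<partial>z\<^sub>i / \<partial>w\<^sub>j\<close> at \<open>x\<close>, where \<open>z\<close> are the coordinates of \<open>c\<close> and \<open>w\<close> those of \<open>c'\<close>.\<close>

definition jac :: "'a chart \<Rightarrow> 'a chart \<Rightarrow> 'a \<Rightarrow> nat \<Rightarrow> nat \<Rightarrow> complex" where
  "jac c c' x i j = cpartial j (\<lambda>w. snd c (chart_inv c' w) i) (snd c' x)"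

definition smooth_fun :: "'a complex_space \<Rightarrow> nat \<Rightarrow> 'a set \<Rightarrow> ('a \<Rightarrow> complex) \<Rightarrow> bool" where
  "smooth_fun X n W f \<longleftrightarrow> (\<forall>c\<in>charts X n W. smooth_Cn n (chart_image c) (f \<circ> chart_inv c))"

definition hermitian_pos_def :: "nat \<Rightarrow> (nat \<Rightarrow> nat \<Rightarrow> complex) \<Rightarrow> bool" where
  "hermitian_pos_def m a \<longleftrightarrow> (\<forall>j<m. \<forall>k<m. a k j = cnj (a j k)) \<and>
     (\<forall>v. (\<exists>j<m. v j \<noteq> 0) \<longrightarrow> 0 < Re (\<Sum>j<m. \<Sum>k<m. a j k * v j * cnj (v k)))"

section \<open>Hermitian metrics on the base and their volume\<close>

text \<open>A hermitian metric is given by its coefficients \<open>g c x j k = \<langle>\<partial>/\<partial>z\<^sub>j, \<partial>/\<partial>z\<^sub>k\<rangle>\<close> in all charts \<open>c\<close>.\<close>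

type_synonym 'a base_metric = "'a chart \<Rightarrow> 'a \<Rightarrow> nat \<Rightarrow> nat \<Rightarrow> complex"

definition hermitian_metric ::
    "'a complex_space \<Rightarrow> nat \<Rightarrow> 'a set \<Rightarrow> 'a base_metric \<Rightarrow> bool" where
  "hermitian_metric X n W g \<longleftrightarrow>
     (\<forall>c\<in>charts X n W.
        (\<forall>x\<in>fst c. hermitian_pos_def n (g c x)) \<and>
        (\<forall>j<n. \<forall>k<n. smooth_Cn n (chart_image c) (\<lambda>z. g c (chart_inv c z) j k))) \<and>
     (\<forall>c\<in>charts X n W. \<forall>c'\<in>charts X n W. \<forall>x\<in>fst c \<inter> fst c'. \<forall>j'<n. \<forall>k'<n.
        g c' x j' k' = (\<Sum>j<n. \<Sum>k<n. jac c c' x j j' * cnj (jac c c' x k k') * g c x j k))"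

definition gram :: "nat \<Rightarrow> 'a base_metric \<Rightarrow> 'a chart \<Rightarrow> 'a \<Rightarrow> complex mat" where
  "gram n g c x = mat n n (\<lambda>(j, k). g c x j k)"

text \<open>
  The volume measure: in a chart \<open>c\<close> the volume form is \<open>det g\<close> times Lebesgue measure; these
  measures agree on overlaps of charts by the change of variables formula, so that the
  measure glued from them is their supremum in the lattice of measures.
\<close>

definition chart_volume ::
    "'a complex_space \<Rightarrow> nat \<Rightarrow> 'a set \<Rightarrow> 'a base_metric \<Rightarrow> 'a chart \<Rightarrow> 'a measure" where
  "chart_volume X n W g c =
     distr (density (restrict_space (lborel_Cn n) (chart_image c))
              (\<lambda>z. ennreal (Re (Determinant.det (gram n g c (chart_inv c z))))))
       (sigma W {V. openin (top_of X) V \<and> V \<subseteq> W}) (chart_inv c)"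

definition volume ::
    "'a complex_space \<Rightarrow> nat \<Rightarrow> 'a set \<Rightarrow> 'a base_metric \<Rightarrow> 'a measure" where
  "volume X n W g = completion (SUP c\<in>charts X n W. chart_volume X n W g c)"

section \<open>Holomorphic vector bundles with singular hermitian metrics\<close>

text \<open>
  A trivialisation over \<open>U\<close> sends a vector of a fibre over \<open>U\<close> to its coordinates with respect
  to a holomorphic frame.  The vector space structure of the fibres is the one transported by
  the trivialisations; it is well defined since the transitions are linear.
\<close>

record ('a, 'e) vbundle =
  total :: "'e set"
  proj :: "'e \<Rightarrow> 'a"
  rank :: nat
  trivs :: "('a set \<times> ('e \<Rightarrow> nat \<Rightarrow> complex)) set"

definition fibre :: "('a, 'e) vbundle \<Rightarrow> 'a \<Rightarrow> 'e set" where
  "fibre E x = {v\<in>total E. proj E v = x}"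

definition holomorphic_vector_bundle ::
    "'a complex_space \<Rightarrow> 'a set \<Rightarrow> ('a, 'e) vbundle \<Rightarrow> bool" where
  "holomorphic_vector_bundle X W E \<longleftrightarrow>
     proj E ` total E \<subseteq> W \<and> (\<Union>\<tau>\<in>trivs E. fst \<tau>) = W \<and>
     (\<forall>\<tau>\<in>trivs E. openin (top_of X) (fst \<tau>) \<and>
        (\<forall>x\<in>fst \<tau>. bij_betw (snd \<tau>) (fibre E x) (topspace (Cn (rank E))))) \<and>
     (\<forall>\<tau>\<in>trivs E. \<forall>\<tau>'\<in>trivs E. \<exists>a. \<forall>k<rank E.
        (\<forall>l<rank E. a k l \<in> str_sheaf X (fst \<tau> \<inter> fst \<tau>')) \<and>
        (\<forall>x\<in>fst \<tau> \<inter> fst \<tau>'. \<forall>v\<in>fibre E x. snd \<tau>' v k = (\<Sum>l<rank E. a k l x * snd \<tau> v l)))"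

definition fibre_zero :: "('a, 'e) vbundle \<Rightarrow> 'a \<Rightarrow> 'e" where
  "fibre_zero E x = (THE v. v \<in> fibre E x \<and> (\<forall>\<tau>\<in>trivs E. x \<in> fst \<tau> \<longrightarrow> (\<forall>k<rank E. snd \<tau> v k = 0)))"

definition smooth_bundle_metric ::
    "'a complex_space \<Rightarrow> nat \<Rightarrow> 'a set \<Rightarrow> ('a, 'e) vbundle \<Rightarrow> ('e \<Rightarrow> 'e \<Rightarrow> complex) \<Rightarrow> bool" where
  "smooth_bundle_metric X n W E H \<longleftrightarrow>
     (\<forall>\<tau>\<in>trivs E. \<exists>m.
        (\<forall>k<rank E. \<forall>l<rank E. smooth_fun X n (fst \<tau>) (\<lambda>x. m x k l)) \<and>
        (\<forall>x\<in>fst \<tau>. hermitian_pos_def (rank E) (m x) \<and>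
           (\<forall>u\<in>fibre E x. \<forall>v\<in>fibre E x.
              H u v = (\<Sum>k<rank E. \<Sum>l<rank E. m x k l * snd \<tau> u k * cnj (snd \<tau> v l)))))"

definition quasi_psh :: "'a complex_space \<Rightarrow> nat \<Rightarrow> 'a set \<Rightarrow> ('a \<Rightarrow> ereal) \<Rightarrow> bool" where
  "quasi_psh X n W \<phi> \<longleftrightarrow>
     (\<forall>x\<in>W. \<exists>c\<in>charts X n W. x \<in> fst c \<and>
        (\<exists>f u. smooth_Cn n (chart_image c) (\<lambda>z. complex_of_real (f z)) \<and> psh_Cn n (chart_image c) u \<and>
           (\<forall>y\<in>fst c. \<phi> y = ereal (f (snd c y)) + u (snd c y))))"

text \<open>The singular metric \<open>e\<^sup>-\<^sup>\<phi> h\<^sub>0\<close> with \<open>h\<^sub>0\<close> the \<open>smooth_part\<close> and \<open>\<phi>\<close> the \<open>weight\<close>.\<close>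

record ('a, 'e) singular_metric =
  smooth_part :: "'e \<Rightarrow> 'e \<Rightarrow> complex"
  weight :: "'a \<Rightarrow> ereal"

definition singular_hermitian_metric ::
    "'a complex_space \<Rightarrow> nat \<Rightarrow> 'a set \<Rightarrow> ('a, 'e) vbundle \<Rightarrow> ('a, 'e) singular_metric \<Rightarrow> bool" where
  "singular_hermitian_metric X n W E h \<longleftrightarrow>
     smooth_bundle_metric X n W E (smooth_part h) \<and> quasi_psh X n W (weight h)"

definition exp_neg :: "ereal \<Rightarrow> ennreal" where
  "exp_neg s = (case s of ereal r \<Rightarrow> ennreal (exp (- r)) | PInfty \<Rightarrow> 0 | MInfty \<Rightarrow> \<infinity>)"

section \<open>Bundle-valued forms\<close>

text \<open>
  A form of bidegree \<open>(p, q)\<close> with values in \<open>E\<close> is given by its components \<open>\<alpha> c x I J\<close> in the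
  fibre \<open>E\<^sub>x\<close>, in every chart \<open>c\<close> and for all (not necessarily increasing) multi-indices \<open>I\<close>, \<open>J\<close>
  of lengths \<open>p\<close>, \<open>q\<close>; the components are alternating in \<open>I\<close> and in \<open>J\<close>, so that
  \<open>\<alpha> = 1 / (p! q!) \<Sum> \<alpha>\<^sub>I\<^sub>J dz\<^sub>I \<and> d\<bar>z\<^sub>J\<close>.
\<close>

type_synonym ('a, 'e) form = "'a chart \<Rightarrow> 'a \<Rightarrow> nat list \<Rightarrow> nat list \<Rightarrow> 'e"

definition multi_idx :: "nat \<Rightarrow> nat \<Rightarrow> nat list set" where
  "multi_idx n p = {I. length I = p \<and> set I \<subseteq> {..<n}}"

definition swap_idx :: "nat \<Rightarrow> nat \<Rightarrow> nat list \<Rightarrow> nat list" where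
  "swap_idx a b I = I[a := I ! b, b := I ! a]"

definition bundle_form ::
    "'a complex_space \<Rightarrow> nat \<Rightarrow> ('a, 'e) vbundle \<Rightarrow> nat \<Rightarrow> nat \<Rightarrow> 'a set \<Rightarrow> ('a, 'e) form \<Rightarrow> bool" where
  "bundle_form X n E p q W \<alpha> \<longleftrightarrow>
     (\<forall>c\<in>charts X n W. \<forall>x\<in>fst c. \<forall>I\<in>multi_idx n p. \<forall>J\<in>multi_idx n q. \<alpha> c x I J \<in> fibre E x) \<and>
     (\<forall>c\<in>charts X n W. \<forall>\<tau>\<in>trivs E. \<forall>x\<in>fst c \<inter> fst \<tau>.
        \<forall>I\<in>multi_idx n p. \<forall>J\<in>multi_idx n q. \<forall>k<rank E.
          (\<forall>b<p. \<forall>a<b. snd \<tau> (\<alpha> c x (swap_idx a b I) J) k = - snd \<tau> (\<alpha> c x I J) k) \<and>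
          (\<forall>b<q. \<forall>a<b. snd \<tau> (\<alpha> c x I (swap_idx a b J)) k = - snd \<tau> (\<alpha> c x I J) k)) \<and>
     (\<forall>c\<in>charts X n W. \<forall>c'\<in>charts X n W. \<forall>\<tau>\<in>trivs E. \<forall>x\<in>fst c \<inter> fst c' \<inter> fst \<tau>.
        \<forall>I'\<in>multi_idx n p. \<forall>J'\<in>multi_idx n q. \<forall>k<rank E.
          snd \<tau> (\<alpha> c' x I' J') k =
            (\<Sum>I\<in>multi_idx n p. \<Sum>J\<in>multi_idx n q.
               (\<Prod>a<p. jac c c' x (I ! a) (I' ! a)) * (\<Prod>b<q. cnj (jac c c' x (J ! b) (J' ! b)))
                 * snd \<tau> (\<alpha> c x I J) k))"

text \<open>The local expression of a component with respect to a holomorphic frame, as a function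
  of the coordinates.\<close>

definition coeff_fun ::
    "('a set \<times> ('e \<Rightarrow> nat \<Rightarrow> complex)) \<Rightarrow> 'a chart \<Rightarrow> ('a, 'e) form \<Rightarrow> nat list \<Rightarrow> nat list \<Rightarrow> nat
       \<Rightarrow> (nat \<Rightarrow> complex) \<Rightarrow> complex" where
  "coeff_fun \<tau> c \<alpha> I J k z = snd \<tau> (\<alpha> c (chart_inv c z) I J) k"

definition measurable_form ::
    "'a complex_space \<Rightarrow> nat \<Rightarrow> ('a, 'e) vbundle \<Rightarrow> nat \<Rightarrow> nat \<Rightarrow> 'a set \<Rightarrow> ('a, 'e) form \<Rightarrow> bool" where
  "measurable_form X n E p q W \<alpha> \<longleftrightarrow> bundle_form X n E p q W \<alpha> \<and>
     (\<forall>c\<in>charts X n W. \<forall>\<tau>\<in>trivs E. fst c \<subseteq> fst \<tau> \<longrightarrow>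
        (\<forall>I\<in>multi_idx n p. \<forall>J\<in>multi_idx n q. \<forall>k<rank E.
           coeff_fun \<tau> c \<alpha> I J k \<in> borel_measurable (restrict_space (lebesgue_Cn n) (chart_image c))))"

definition zero_form :: "('a, 'e) vbundle \<Rightarrow> ('a, 'e) form" where
  "zero_form E = (\<lambda>c x I J. fibre_zero E x)"

text \<open>
  \<open>\<beta> = \<partial>\<bar>\<alpha>\<close> in the sense of distributions, i.e. in every chart and holomorphic frame the components satisfy
  \<open>\<beta>\<^sub>I\<^sub>K = (-1)\<^sup>p \<Sum>\<^sub>a (-1)\<^sup>a \<partial>\<alpha>\<^sub>I\<^sub>J / \<partial>\<bar>z\<^sub>j\<close> weakly, where \<open>j\<close> is the \<open>a\<close>-th entry of \<open>K\<close>
  (counted from \<open>0\<close>) and \<open>J\<close> is \<open>K\<close> with that entry removed.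
\<close>

definition weak_dbar ::
    "'a complex_space \<Rightarrow> nat \<Rightarrow> ('a, 'e) vbundle \<Rightarrow> nat \<Rightarrow> nat \<Rightarrow> 'a set
       \<Rightarrow> ('a, 'e) form \<Rightarrow> ('a, 'e) form \<Rightarrow> bool" where
  "weak_dbar X n E p q W \<alpha> \<beta> \<longleftrightarrow>
     measurable_form X n E p q W \<alpha> \<and> measurable_form X n E p (Suc q) W \<beta> \<and>
     (\<forall>c\<in>charts X n W. \<forall>\<tau>\<in>trivs E. fst c \<subseteq> fst \<tau> \<longrightarrow>
        (\<forall>I\<in>multi_idx n p. \<forall>k<rank E.
           (\<forall>J\<in>multi_idx n q. locally_integrable_Cn n (chart_image c) (coeff_fun \<tau> c \<alpha> I J k)) \<and>
           (\<forall>K\<in>multi_idx n (Suc q). locally_integrable_Cn n (chart_image c) (coeff_fun \<tau> c \<beta> I K k) \<and>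
              (\<forall>\<psi>. test_function n (chart_image c) \<psi> \<longrightarrow>
                 (LINT z:chart_image c|lebesgue_Cn n. coeff_fun \<tau> c \<beta> I K k z * \<psi> z) =
                 - (\<Sum>a<Suc q. (-1) ^ (p + a) *
                      (LINT z:chart_image c|lebesgue_Cn n.
                         coeff_fun \<tau> c \<alpha> I (take a K @ drop (Suc a) K) k z
                           * dbar_partial (K ! a) \<psi> z))))))"

text \<open>
  The pointwise squared norm of a form in the chart \<open>c\<close>.  With \<open>g\<^sub>j\<^sub>k = \<langle>\<partial>/\<partial>z\<^sub>j, \<partial>/\<partial>z\<^sub>k\<rangle>\<close> the dual metric is
  \<open>\<langle>dz\<^sub>j, dz\<^sub>k\<rangle> = (g\<^sup>-\<^sup>1)\<^sub>k\<^sub>j\<close> and \<open>\<langle>d\<bar>z\<^sub>j, d\<bar>z\<^sub>k\<rangle> = (g\<^sup>-\<^sup>1)\<^sub>j\<^sub>k\<close>.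
\<close>

definition chart_norm_sq ::
    "nat \<Rightarrow> ('a, 'e) vbundle \<Rightarrow> ('a, 'e) singular_metric \<Rightarrow> 'a base_metric \<Rightarrow> nat \<Rightarrow> nat
       \<Rightarrow> ('a, 'e) form \<Rightarrow> 'a chart \<Rightarrow> 'a \<Rightarrow> ennreal" where
  "chart_norm_sq n E h g p q \<alpha> c x = exp_neg (weight h x) * ennreal (Re (
     (let G = the (mat_inverse (gram n g c x)) in
       (\<Sum>I\<in>multi_idx n p. \<Sum>I'\<in>multi_idx n p. \<Sum>J\<in>multi_idx n q. \<Sum>J'\<in>multi_idx n q.
          (\<Prod>a<p. G $$ (I' ! a, I ! a)) * (\<Prod>b<q. G $$ (J ! b, J' ! b))
            * smooth_part h (\<alpha> c x I J) (\<alpha> c x I' J')))) / (fact p * fact q))"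

text \<open>By the transformation laws the norm does not depend on the chart that is chosen.\<close>

definition norm_sq ::
    "'a complex_space \<Rightarrow> nat \<Rightarrow> 'a set \<Rightarrow> ('a, 'e) vbundle \<Rightarrow> ('a, 'e) singular_metric \<Rightarrow> 'a base_metric
       \<Rightarrow> nat \<Rightarrow> nat \<Rightarrow> ('a, 'e) form \<Rightarrow> 'a \<Rightarrow> ennreal" where
  "norm_sq X n W E h g p q \<alpha> x =
     chart_norm_sq n E h g p q \<alpha> (SOME c. c \<in> charts X n W \<and> x \<in> fst c) x"

section \<open>The sheaves\<close>

text \<open>
  Sections over \<open>U\<close> are represented by measurable forms on \<open>U \<inter> Xo\<close>; forms that agree almost
  everywhere represent the same section, and membership depends only on the class.
\<close>

definition square_integrable_form ::
    "'a complex_space \<Rightarrow> nat \<Rightarrow> 'a set \<Rightarrow> ('a, 'e) vbundle \<Rightarrow> ('a, 'e) singular_metric \<Rightarrow> 'a base_metric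
       \<Rightarrow> nat \<Rightarrow> nat \<Rightarrow> 'a set \<Rightarrow> 'a set \<Rightarrow> ('a, 'e) form \<Rightarrow> bool" where
  "square_integrable_form X n Xo E h g p q U V \<alpha> \<longleftrightarrow>
     (\<integral>\<^sup>+y\<in>V \<inter> Xo. norm_sq X n (U \<inter> Xo) E h g p q \<alpha> y \<partial>volume X n Xo g) < \<infinity>"

definition D_sheaf ::
    "'a complex_space \<Rightarrow> nat \<Rightarrow> 'a set \<Rightarrow> ('a, 'e) vbundle \<Rightarrow> ('a, 'e) singular_metric \<Rightarrow> 'a base_metric
       \<Rightarrow> nat \<Rightarrow> nat \<Rightarrow> 'a set \<Rightarrow> ('a, 'e) form set" where
  "D_sheaf X n Xo E h g p q U = {\<alpha>. measurable_form X n E p q (U \<inter> Xo) \<alpha> \<and>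
     (\<exists>\<beta>. weak_dbar X n E p q (U \<inter> Xo) \<alpha> \<beta> \<and>
        (\<forall>x\<in>U. \<exists>V. openin (top_of X) V \<and> x \<in> V \<and> V \<subseteq> U \<and>
           square_integrable_form X n Xo E h g p q U V \<alpha> \<and>
           square_integrable_form X n Xo E h g p (Suc q) U V \<beta>))}"

definition S_sheaf ::
    "'a complex_space \<Rightarrow> nat \<Rightarrow> 'a set \<Rightarrow> ('a, 'e) vbundle \<Rightarrow> ('a, 'e) singular_metric \<Rightarrow> 'a base_metric
       \<Rightarrow> 'a set \<Rightarrow> ('a, 'e) form set" where
  "S_sheaf X n Xo E h g U =
     {\<alpha>\<in>D_sheaf X n Xo E h g n 0 U. weak_dbar X n E n 0 (U \<inter> Xo) \<alpha> (zero_form E)}"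

end

theory Submission
  imports Defs
begin

text \<open>
  For forms of bidegree \<open>(n, 0)\<close> the product of the pointwise squared norm and the volume form does
  not involve the metric of the base.  In coordinates \<open>\<alpha> = v dz\<^sub>1 \<and> \<dots> \<and> dz\<^sub>n\<close> the squared norm is
  \<open>\<bar>v\<bar>\<^sup>2 / det g\<close>, with \<open>\<bar>v\<bar>\<close> measured by \<open>h\<close>, while the volume form is \<open>det g\<close> times
  Lebesgue measure.  Hence square integrability near a point, singular points of the space included,
  means the same for every metric.  The kernel condition \<open>\<partial>\<bar>\<alpha> = 0\<close> does not involve the metric at all,
  and the derivative of a section in the kernel may be taken to be the zero form, which has norm zero
  (\<open>norm_sq_zero_form\<close>).

  The pointwise part is \<open>chart_norm_sq_top_form\<close>: the coefficients of \<open>\<alpha>\<close> are alternating, so the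
  sum over pairs of multi-indices collapses to the determinant of the inverse of \<open>g\<close>
  (\<open>alternating_pairing_eq_det\<close>), which is positive since \<open>g\<close> is positive definite (\<open>hermitian_pos_def_det_pos\<close>).

  For the measures, the quotient \<open>r = det g2 / det g1\<close> is the same in all charts, because both determinants
  change by the squared modulus of the same Jacobian determinant.  The volume of \<open>g2\<close> is at
  most \<open>r\<close> times the volume of \<open>g1\<close>, since this holds for the volumes of the single charts and the
  volume is their least upper bound (\<open>nn_integral_volume_le\<close>).  As \<open>r\<close> times the norm for \<open>g2\<close>
  is at most the norm for \<open>g1\<close> (\<open>volume_ratio_norm_sq\<close>), integrability for \<open>g1\<close> implies
  integrability for \<open>g2\<close>.  This gives one inclusion of the sheaves, and exchanging the metrics gives
  the other; so inequalities suffice throughout.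
\<close>

section \<open>Determinants of positive definite hermitian matrices\<close>

lemma permutes_upt_less:
  fixes p :: "nat \<Rightarrow> nat"
  shows "p permutes {0..<n} \<Longrightarrow> i < n \<Longrightarrow> p i < n"
  using permutes_in_image[of p "{0..<n}" i] by simp

lemma hermitian_pos_def_det_nonzero:
  assumes "hermitian_pos_def m a"
  shows "Determinant.det (mat m m (\<lambda>(j, k). a j k)) \<noteq> 0"
proof
  let ?A = "mat m m (\<lambda>(j, k). a j k)"
  assume "Determinant.det ?A = 0"
  then obtain v where v: "v \<in> carrier_vec m" "v \<noteq> 0\<^sub>v m" "?A *\<^sub>v v = 0\<^sub>v m"
    using det_0_iff_vec_prod_zero[of ?A m] by auto
  \<comment> \<open>The quadratic form has the conjugate on its second argument, so a kernel vector must be conjugated.\<close>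
  let ?w = "\<lambda>j. cnj (vec_index v j)"
  have row: "(\<Sum>k<m. a j k * cnj (?w k)) = 0" if "j < m" for j
  proof -
    have "vec_index (?A *\<^sub>v v) j = (\<Sum>k<m. a j k * vec_index v k)"
      using that v(1) by (simp add: scalar_prod_def atLeast0LessThan)
    then show ?thesis using v(3) that by simp
  qed
  have "(\<Sum>j<m. \<Sum>k<m. a j k * ?w j * cnj (?w k)) = (\<Sum>j<m. ?w j * (\<Sum>k<m. a j k * cnj (?w k)))"
    by (simp add: sum_distrib_left mult_ac)
  also have "\<dots> = 0" using row by simp
  finally have zero: "(\<Sum>j<m. \<Sum>k<m. a j k * ?w j * cnj (?w k)) = 0" .
  have "\<exists>j<m. ?w j \<noteq> 0" using v(1,2) by (metis complex_cnj_zero_iff eq_vecI carrier_vecD index_zero_vec)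
  then have "0 < Re (\<Sum>j<m. \<Sum>k<m. a j k * ?w j * cnj (?w k))"
    using assms unfolding hermitian_pos_def_def by (meson)
  then show False unfolding zero by simp
qed

lemma hermitian_det_real:
  assumes "\<forall>j<m. \<forall>k<m. a k j = cnj (a j k)"
  shows "Im (Determinant.det (mat m m (\<lambda>(j, k). a j k))) = 0"
proof -
  let ?A = "mat m m (\<lambda>(j, k). a j k)"
  have "cnj (Determinant.det ?A) = Determinant.det (transpose_mat ?A)"
  proof -
    have t: "transpose_mat ?A = mat m m (\<lambda>(j, k). a k j)" by (rule eq_matI) auto
    interpret cnj: comm_ring_hom cnj by unfold_locales auto
    have "Determinant.det (map_mat cnj ?A) = cnj (Determinant.det ?A)" by simp
    moreover have "map_mat cnj ?A = transpose_mat ?A"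
      unfolding t using assms[rule_format, symmetric] by (intro eq_matI) simp_all
    ultimately show ?thesis by simp
  qed
  also have "\<dots> = Determinant.det ?A" by (rule det_transpose) auto
  finally show ?thesis by (simp add: complex_eq_iff)
qed

text \<open>
  The positive definite hermitian matrices form a convex set containing the identity.  On the
  segment from the identity to the given matrix the determinant is real and has no zero, so it keeps
  the sign that it has at the identity.
\<close>

lemma hermitian_pos_def_det_pos:
  assumes a: "hermitian_pos_def m a"
  defines "D \<equiv> Determinant.det (mat m m (\<lambda>(j, k). a j k))"
  shows "0 < Re D" "Im D = 0"
proof -
  define b :: "real \<Rightarrow> nat \<Rightarrow> nat \<Rightarrow> complex" where
    "b t j k = complex_of_real (1 - t) * (if j = k then 1 else 0) + complex_of_real t * a j k" for t j k
  define f where "f t = Re (Determinant.det (mat m m (\<lambda>(j, k). b t j k)))" for t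
  have hb: "hermitian_pos_def m (b t)" if t: "0 \<le> t" "t \<le> 1" for t
    unfolding hermitian_pos_def_def
  proof (intro conjI allI impI)
    fix j k assume "j < m" "k < m"
    then have "a k j = cnj (a j k)" using a unfolding hermitian_pos_def_def by blast
    then show "b t k j = cnj (b t j k)" by (simp add: b_def)
  next
    fix v :: "nat \<Rightarrow> complex" assume v: "\<exists>j<m. v j \<noteq> 0"
    let ?q = "\<Sum>j<m. \<Sum>k<m. a j k * v j * cnj (v k)"
    have "(\<Sum>j<m. \<Sum>k<m. b t j k * v j * cnj (v k))
        = (\<Sum>j<m. \<Sum>k<m. complex_of_real (1 - t) * (if j = k then v j * cnj (v k) else 0)
              + complex_of_real t * (a j k * v j * cnj (v k)))"
      by (intro sum.cong refl) (simp add: b_def algebra_simps)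
    also have "\<dots> = complex_of_real (1 - t) * (\<Sum>j<m. v j * cnj (v j)) + complex_of_real t * ?q"
      by (simp add: sum.distrib sum_distrib_left[symmetric] flip: sum_distrib_left)
    finally have eq: "Re (\<Sum>j<m. \<Sum>k<m. b t j k * v j * cnj (v k))
        = (1 - t) * (\<Sum>j<m. (cmod (v j))\<^sup>2) + t * Re ?q"
      by (simp add: complex_norm_square[symmetric] del: complex_mult_cnj)
    have q: "0 < Re ?q" using a v unfolding hermitian_pos_def_def by blast
    have s: "0 < (\<Sum>j<m. (cmod (v j))\<^sup>2)"
      using v by (auto intro!: sum_pos2)
    show "0 < Re (\<Sum>j<m. \<Sum>k<m. b t j k * v j * cnj (v k))"
      unfolding eq using q s t by (cases "t = 0") (simp_all add: add_nonneg_pos)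
  qed
  have expand: "f t = Re (\<Sum>p | p permutes {0..<m}. signof p * (\<Prod>i = 0..<m. b t i (p i)))" for t
    unfolding f_def det_def'[OF mat_carrier]
    by (intro arg_cong[where f=Re] sum.cong prod.cong refl arg_cong2[where f="(*)"])
       (simp add: permutes_upt_less)
  have cont: "continuous_on {0..1} f"
    unfolding expand b_def by (intro continuous_intros)
  have nz: "f t \<noteq> 0" if "0 \<le> t" "t \<le> 1" for t
  proof -
    have "Im (Determinant.det (mat m m (\<lambda>(j, k). b t j k))) = 0"
      using hb[OF that] unfolding hermitian_pos_def_def by (intro hermitian_det_real) blast
    then show ?thesis
      using hermitian_pos_def_det_nonzero[OF hb[OF that]] unfolding f_def complex_eq_iff by simp
  qed
  have "mat m m (\<lambda>(j, k). b 0 j k) = 1\<^sub>m m" by (rule eq_matI) (auto simp: b_def)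
  then have "f 0 = 1" unfolding f_def by simp
  moreover have "f 1 = Re D" by (simp add: f_def D_def b_def)
  ultimately show "0 < Re D"
    using IVT2'[of f 1 0 0] cont nz by (metis linorder_not_less order_less_imp_le zero_le_one)
  show "Im D = 0" unfolding D_def using a hermitian_det_real[of m a] unfolding hermitian_pos_def_def by blast
qed

lemma det_mat_inverse:
  fixes A :: "'k::field mat"
  assumes A: "A \<in> carrier_mat n n" and nz: "Determinant.det A \<noteq> 0"
  shows "the (mat_inverse A) \<in> carrier_mat n n"
    and "Determinant.det (the (mat_inverse A)) = 1 / Determinant.det A"
proof -
  have "A \<in> Units (ring_mat TYPE('k) n undefined)" by (rule det_non_zero_imp_unit[OF A nz])
  then obtain B where B: "mat_inverse A = Some B"
    using mat_inverse(1)[OF A, of undefined] by (cases "mat_inverse A") auto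
  then have inv: "A * B = 1\<^sub>m n" "B \<in> carrier_mat n n" using mat_inverse(2)[OF A] by auto
  show "the (mat_inverse A) \<in> carrier_mat n n" using B inv(2) by simp
  have "Determinant.det A * Determinant.det B = 1"
    using det_mult[OF A inv(2)] inv(1) by simp
  then show "Determinant.det (the (mat_inverse A)) = 1 / Determinant.det A"
    using B nz by (simp add: field_simps)
qed

section \<open>Alternating functions of multi-indices\<close>

text \<open>
  A function alternating in \<open>n\<close> indices from \<open>{..<n}\<close> is determined by its value at
  \<open>[0..<n]\<close>: forms of top degree have only one independent coefficient.
\<close>

lemma alternating_map_permutation:
  fixes A :: "nat list \<Rightarrow> complex"
  assumes alt: "\<And>I a b. I \<in> multi_idx n n \<Longrightarrow> a < b \<Longrightarrow> b < n \<Longrightarrow> A (swap_idx a b I) = - A I"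
    and p: "p permutes {0..<n}"
  shows "A (map p [0..<n]) = signof p * A [0..<n]"
proof -
  have "A (map p [0..<n]) = of_int (sign p) * A [0..<n]"
    using finite_atLeastLessThan[of 0 n] p
  proof (induction p rule: permutes_rev_induct)
    case id then show ?case by simp
  next
    case (swap a b p)
    \<comment> \<open>The alternating law is given for swaps of positions in increasing order only.\<close>
    define c d where "c = min a b" and "d = max a b"
    have cd: "c < d" "d < n" "Transposition.transpose a b = Transposition.transpose c d"
      using swap(1-3) by (auto simp: c_def d_def min_def max_def transpose_commute)
    have "map (p \<circ> Transposition.transpose a b) [0..<n] = swap_idx c d (map p [0..<n])"
      unfolding cd(3) swap_idx_def
      by (rule nth_equalityI) (use cd in \<open>auto simp: nth_list_update transpose_def\<close>)
    moreover have "map p [0..<n] \<in> multi_idx n n"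
      using \<open>p permutes {0..<n}\<close> by (auto simp: multi_idx_def permutes_upt_less)
    ultimately have "A (map (p \<circ> Transposition.transpose a b) [0..<n]) = - A (map p [0..<n])"
      using alt cd by simp
    moreover have "sign (p \<circ> Transposition.transpose a b) = - sign p"
      using swap(3) \<open>p permutes {0..<n}\<close>
      by (subst sign_compose) (auto simp: permutation_swap_id sign_swap_id intro: permutes_imp_permutation)
    ultimately show ?case using swap.IH by (simp only:) simp
  qed
  then show ?thesis by simp
qed


lemma alternating_not_distinct:
  fixes A :: "nat list \<Rightarrow> complex"
  assumes alt: "\<And>I a b. I \<in> multi_idx n n \<Longrightarrow> a < b \<Longrightarrow> b < n \<Longrightarrow> A (swap_idx a b I) = - A I"
    and I: "I \<in> multi_idx n n" "\<not> distinct I"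
  shows "A I = 0"
proof -
  obtain a b where ab: "a < b" "b < n" "I ! a = I ! b"
    using I unfolding distinct_conv_nth multi_idx_def by (metis (mono_tags, lifting) mem_Collect_eq nat_neq_iff)
  then have "swap_idx a b I = I"
    unfolding swap_idx_def by (metis list_update_id)
  then show ?thesis using alt[OF I(1) ab(1,2)] by simp
qed

lemma sum_multi_idx_permutations:
  fixes f :: "nat list \<Rightarrow> 'b::comm_monoid_add"
  assumes "\<And>I. I \<in> multi_idx n n \<Longrightarrow> \<not> distinct I \<Longrightarrow> f I = 0"
  shows "(\<Sum>I\<in>multi_idx n n. f I) = (\<Sum>p | p permutes {0..<n}. f (map p [0..<n]))"
proof -
  let ?D = "{I\<in>multi_idx n n. distinct I}"
  have fin: "finite (multi_idx n n)"
    unfolding multi_idx_def by (rule finite_subset[OF _ finite_lists_length_eq[of "{..<n}" n]]) auto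
  have "(\<Sum>I\<in>multi_idx n n. f I) = sum f ?D"
    using fin assms by (intro sum.mono_neutral_right) auto
  also have "\<dots> = (\<Sum>p | p permutes {0..<n}. f (map p [0..<n]))"
  proof (rule sum.reindex_bij_betw[symmetric], rule bij_betwI')
    fix p q assume "p \<in> {p. p permutes {0..<n}}" "q \<in> {p. p permutes {0..<n}}"
    then have pq: "p permutes {0..<n}" "q permutes {0..<n}" by auto
    show "map p [0..<n] = map q [0..<n] \<longleftrightarrow> p = q"
    proof
      assume "map p [0..<n] = map q [0..<n]"
      then have "p i = q i" if "i < n" for i using that by (simp add: map_eq_conv)
      moreover have "p i = q i" if "\<not> i < n" for i
        using that pq by (simp add: permutes_not_in)
      ultimately show "p = q" by blast
    qed simp
  next
    fix p assume "p \<in> {p. p permutes {0..<n}}"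
    then show "map p [0..<n] \<in> ?D"
      by (auto simp: multi_idx_def permutes_upt_less distinct_map intro: permutes_inj_on)
  next
    fix I assume "I \<in> ?D"
    then have I: "length I = n" "set I \<subseteq> {..<n}" "distinct I" by (auto simp: multi_idx_def)
    define p where "p i = (if i < n then I ! i else i)" for i
    have "inj_on p {0..<n}"
      using I by (auto simp: p_def inj_on_def nth_eq_iff_index_eq)
    moreover have "p ` {0..<n} \<subseteq> {0..<n}"
      using I(1,2) nth_mem by (fastforce simp: p_def)
    ultimately have "bij_betw p {0..<n} {0..<n}"
      by (simp add: bij_betw_def endo_inj_surj)
    then have "p permutes {0..<n}"
      by (rule bij_imp_permutes) (simp add: p_def)
    moreover have "I = map p [0..<n]"
      using I by (intro nth_equalityI) (auto simp: p_def)
    ultimately show "\<exists>p\<in>{p. p permutes {0..<n}}. I = map p [0..<n]" by blast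
  qed
  finally show ?thesis .
qed

text \<open>
  For fixed \<open>I' = map q [0..<n]\<close>, the sum over \<open>I\<close> is the Leibniz expansion of the
  determinant of \<open>G\<close> with its rows permuted by \<open>q\<close>.  The sign of \<open>q\<close> then occurs
  twice, and each of the \<open>n!\<close> values of \<open>q\<close> contributes the same amount.  This is why
  the metric enters the norm of a form of top degree only through its determinant.
\<close>

lemma alternating_pairing_eq_det:
  fixes A B :: "nat list \<Rightarrow> complex"
  assumes A: "\<And>I a b. I \<in> multi_idx n n \<Longrightarrow> a < b \<Longrightarrow> b < n \<Longrightarrow> A (swap_idx a b I) = - A I"
    and B: "\<And>I a b. I \<in> multi_idx n n \<Longrightarrow> a < b \<Longrightarrow> b < n \<Longrightarrow> B (swap_idx a b I) = - B I"
    and G: "G \<in> carrier_mat n n"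
  shows "(\<Sum>I\<in>multi_idx n n. \<Sum>I'\<in>multi_idx n n. (\<Prod>a<n. G $$ (I' ! a, I ! a)) * (A I * B I'))
      = fact n * Determinant.det G * (A [0..<n] * B [0..<n])"
proof -
  let ?P = "{p. p permutes {0..<n}}"
  have "(\<Sum>I\<in>multi_idx n n. \<Sum>I'\<in>multi_idx n n. (\<Prod>a<n. G $$ (I' ! a, I ! a)) * (A I * B I'))
      = (\<Sum>p\<in>?P. \<Sum>q\<in>?P. (\<Prod>a<n. G $$ (map q [0..<n] ! a, map p [0..<n] ! a))
            * (A (map p [0..<n]) * B (map q [0..<n])))"
  proof -
    have inner: "(\<Sum>I'\<in>multi_idx n n. (\<Prod>a<n. G $$ (I' ! a, I ! a)) * (A I * B I'))
        = (\<Sum>q\<in>?P. (\<Prod>a<n. G $$ (map q [0..<n] ! a, I ! a)) * (A I * B (map q [0..<n])))" for I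
      using alternating_not_distinct[OF B] by (intro sum_multi_idx_permutations) simp
    show ?thesis
      unfolding inner using alternating_not_distinct[OF A] by (intro sum_multi_idx_permutations) simp
  qed
  also have "\<dots> = (\<Sum>p\<in>?P. \<Sum>q\<in>?P. (\<Prod>a<n. G $$ (q a, p a))
            * (signof p * A [0..<n] * (signof q * B [0..<n])))"
    using alternating_map_permutation[OF A] alternating_map_permutation[OF B]
    by (intro sum.cong refl arg_cong2[where f="(*)"] prod.cong) simp_all
  also have "\<dots> = (\<Sum>q\<in>?P. signof q * (\<Sum>p\<in>?P. signof p * (\<Prod>a = 0..<n. G $$ (q a, p a))))
            * (A [0..<n] * B [0..<n])"
    by (subst sum.swap) (simp add: sum_distrib_left sum_distrib_right mult_ac atLeast0LessThan)
  also have "(\<Sum>q\<in>?P. signof q * (\<Sum>p\<in>?P. signof p * (\<Prod>a = 0..<n. G $$ (q a, p a))))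
      = (\<Sum>q\<in>?P. Determinant.det G)"
  proof (intro sum.cong refl)
    fix q assume "q \<in> ?P"
    then have q: "q permutes {0..<n}" by simp
    have "(\<Sum>p\<in>?P. signof p * (\<Prod>a = 0..<n. G $$ (q a, p a)))
        = Determinant.det (mat n n (\<lambda>(i, j). G $$ (q i, j)))"
      unfolding det_def'[OF mat_carrier]
      by (intro sum.cong refl arg_cong2[where f="(*)"] prod.cong) (auto simp: permutes_upt_less)
    also have "\<dots> = signof q * Determinant.det G" by (rule det_permute_rows[OF G q])
    finally show "signof q * (\<Sum>p\<in>?P. signof p * (\<Prod>a = 0..<n. G $$ (q a, p a))) = Determinant.det G"
      by (simp add: mult.assoc[symmetric] of_int_mult[symmetric] del: of_int_mult)
  qed
  also have "(\<Sum>q\<in>?P. Determinant.det G) = fact n * Determinant.det G"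
    using card_permutations[of "{0..<n}" n] by simp
  finally show ?thesis .
qed

section \<open>Densities and Borel sets\<close>

text \<open>
  The integral of an arbitrary \<open>f\<close> is the supremum of the integrals of the simple functions
  below it; for these the usual formula holds, and multiplied by \<open>r\<close> they lie below \<open>r * f\<close>.
  The inequality is meant for the squared norm of a form, which is defined by choosing a chart at each
  point separately, so that its measurability is not evident.
\<close>

lemma nn_integral_density_le:
  assumes r: "r \<in> borel_measurable M"
  shows "(\<integral>\<^sup>+x. f x \<partial>density M r) \<le> (\<integral>\<^sup>+x. r x * f x \<partial>M)"
proof -
  have "integral\<^sup>S (density M r) g \<le> (\<integral>\<^sup>+x. r x * f x \<partial>M)"
    if g: "simple_function (density M r) g" "g \<le> f" for g
  proof -
    have "integral\<^sup>S (density M r) g = (\<integral>\<^sup>+x. g x \<partial>density M r)"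
      using nn_integral_eq_simple_integral[OF g(1)] by simp
    also have "\<dots> = (\<integral>\<^sup>+x. r x * g x \<partial>M)"
      using r borel_measurable_simple_function[OF g(1)] by (intro nn_integral_density) auto
    also have "\<dots> \<le> (\<integral>\<^sup>+x. r x * f x \<partial>M)"
      using g(2) by (intro nn_integral_mono mult_left_mono) (auto simp: le_fun_def)
    finally show ?thesis .
  qed
  then show ?thesis
    by (subst nn_integral_def) (auto intro!: SUP_least)
qed

text \<open>
  Every open set is a countable union of boxes whose sides belong to a countable basis of the
  topology of the complex plane.
\<close>

lemma openin_Cn_imp_sets:
  assumes "openin (Cn n) D"
  shows "D \<in> sets (lborel_Cn n)"
proof -
  obtain B :: "complex set set" where B: "countable B" "topological_basis B"
    using ex_countable_basis by blast
  define \<B> where "\<B> = {b\<in>PiE {..<n} (\<lambda>_. B). PiE {..<n} b \<subseteq> D}"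
  have "countable (PiE {..<n} (\<lambda>_. B))"
    using B(1) by (intro countable_PiE) auto
  then have cnt: "countable \<B>"
    unfolding \<B>_def by (rule countable_subset[rotated]) auto
  have "D = (\<Union>b\<in>\<B>. PiE {..<n} b)"
  proof (intro equalityI subsetI)
    fix z assume z: "z \<in> D"
    obtain U where U: "\<And>i. i < n \<Longrightarrow> open (U i)" "z \<in> PiE {..<n} U" "PiE {..<n} U \<subseteq> D"
      using assms z unfolding Cn_def openin_product_topology_alt by (metis lessThan_iff open_openin)
    have "\<exists>b. b \<in> B \<and> z i \<in> b \<and> b \<subseteq> U i" if "i < n" for i
    proof -
      have "z i \<in> U i" using U(2) that by (auto simp: PiE_iff)
      then show ?thesis by (rule topological_basisE[OF B(2) U(1)[OF that]]) blast
    qed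
    then obtain b where b: "\<And>i. i < n \<Longrightarrow> b i \<in> B \<and> z i \<in> b i \<and> b i \<subseteq> U i"
      by metis
    let ?b = "restrict b {..<n}"
    have "PiE {..<n} ?b \<subseteq> PiE {..<n} U" using b by (intro PiE_mono) auto
    then have "?b \<in> \<B>" using b U(3) by (auto simp: \<B>_def)
    moreover have "z \<in> PiE {..<n} ?b" using b U(2) by (auto simp: PiE_iff)
    ultimately show "z \<in> (\<Union>b\<in>\<B>. PiE {..<n} b)" by blast
  qed (auto simp: \<B>_def)
  moreover have "PiE {..<n} b \<in> sets (lborel_Cn n)" if "b \<in> \<B>" for b
    unfolding lborel_Cn_def using that topological_basis_open[OF B(2)]
    by (intro sets_PiM_I_finite) (auto simp: \<B>_def PiE_iff)
  ultimately show ?thesis using cnt by (metis sets.countable_UN' image_subset_iff)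
qed

lemma topspace_Cn: "topspace (Cn n) = space (lborel_Cn n)"
  by (simp add: Cn_def lborel_Cn_def space_PiM)

lemma space_restrict_Cn:
  assumes "openin (Cn n) D"
  shows "space (restrict_space (lborel_Cn n) D) = D"
  using openin_subset[OF assms] by (auto simp: space_restrict_space topspace_Cn)

lemma openin_imp_sets_restrict_Cn:
  assumes "openin (Cn n) D" "openin (Cn n) V" "V \<subseteq> D"
  shows "V \<in> sets (restrict_space (lborel_Cn n) D)"
  using openin_Cn_imp_sets[OF assms(2)] assms(3) by (auto simp: sets_restrict_space)

lemma continuous_map_imp_measurable_Cn:
  assumes D: "openin (Cn n) D" and f: "continuous_map (subtopology (Cn n) D) euclidean f"
  shows "f \<in> borel_measurable (restrict_space (lborel_Cn n) D)"
proof (rule borel_measurableI)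
  fix S :: "'a set" assume "open S"
  then have "openin (subtopology (Cn n) D) {z \<in> D. f z \<in> S}"
    using f openin_subset[OF D] unfolding continuous_map_def by (auto simp: Int_absorb1)
  then have "openin (Cn n) {z \<in> D. f z \<in> S}"
    using D openin_trans_full by blast
  moreover have "f -` S \<inter> space (restrict_space (lborel_Cn n) D) = {z \<in> D. f z \<in> S}"
    unfolding space_restrict_Cn[OF D] by auto
  ultimately show "f -` S \<inter> space (restrict_space (lborel_Cn n) D) \<in> sets (restrict_space (lborel_Cn n) D)"
    using openin_imp_sets_restrict_Cn[OF D] by simp
qed

section \<open>The volume form and its dependence on the metric\<close>

lemma chartsD:
  assumes "c \<in> charts X n W"
  shows "openin (top_of X) (fst c)" "fst c \<subseteq> W" "openin (Cn n) (chart_image c)"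
    "homeomorphic_map (subtopology (top_of X) (fst c)) (subtopology (Cn n) (chart_image c)) (snd c)"
    "inj_on (snd c) (fst c)"
proof -
  show o: "openin (top_of X) (fst c)" "fst c \<subseteq> W" "openin (Cn n) (chart_image c)"
    and h: "homeomorphic_map (subtopology (top_of X) (fst c)) (subtopology (Cn n) (chart_image c)) (snd c)"
    using assms by (auto simp: charts_def coord_chart_def model_chart_def split: prod.splits)
  show "inj_on (snd c) (fst c)"
    using homeomorphic_imp_injective_map[OF h] openin_subset[OF o(1)] by (simp add: Int_absorb1)
qed

lemma openin_chart_image:
  assumes c: "c \<in> charts X n W" and V: "openin (top_of X) V" "V \<subseteq> fst c"
  shows "openin (Cn n) (snd c ` V)"
proof -
  have "openin (subtopology (top_of X) (fst c)) V"
    using V by (simp add: openin_open_subtopology[OF chartsD(1)[OF c]])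
  then have "openin (subtopology (Cn n) (chart_image c)) (snd c ` V)"
    using homeomorphic_map_openness_eq[OF chartsD(4)[OF c]] by blast
  then show ?thesis using chartsD(3)[OF c] openin_trans_full by blast
qed

text \<open>
  The \<open>\<sigma>\<close>-algebra on which all chart volumes live.  Only its sets matter; the measure carried by
  \<^const>\<open>sigma\<close> is zero.
\<close>

definition volume_algebra :: "'a complex_space \<Rightarrow> 'a set \<Rightarrow> 'a measure" where
  "volume_algebra X W = sigma W {V. openin (top_of X) V \<and> V \<subseteq> W}"

lemma space_volume_algebra: "space (volume_algebra X W) = W"
  by (simp add: volume_algebra_def space_measure_of_conv)

lemma openin_imp_sets_volume_algebra:
  "openin (top_of X) V \<Longrightarrow> V \<subseteq> W \<Longrightarrow> V \<in> sets (volume_algebra X W)"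
  by (auto simp: volume_algebra_def)

lemma sets_chart_volume: "sets (chart_volume X n W g c) = sets (volume_algebra X W)"
  by (simp add: chart_volume_def volume_algebra_def)

lemma chart_inv_measurable:
  assumes c: "c \<in> charts X n W"
  shows "chart_inv c \<in> restrict_space (lborel_Cn n) (chart_image c) \<rightarrow>\<^sub>M volume_algebra X W"
  unfolding volume_algebra_def
proof (rule measurable_measure_of)
  note D = chartsD[OF c]
  show "{V. openin (top_of X) V \<and> V \<subseteq> W} \<subseteq> Pow W" by auto
  show "chart_inv c \<in> space (restrict_space (lborel_Cn n) (chart_image c)) \<rightarrow> W"
    unfolding space_restrict_Cn[OF D(3)] using D(2) by (auto simp: D(5))
  fix V assume "V \<in> {V. openin (top_of X) V \<and> V \<subseteq> W}"
  then have V: "openin (top_of X) (V \<inter> fst c)" using D(1) by (auto intro: openin_Int)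
  have "chart_inv c -` V \<inter> space (restrict_space (lborel_Cn n) (chart_image c)) = snd c ` (V \<inter> fst c)"
    unfolding space_restrict_Cn[OF D(3)] by (auto simp: D(5))
  then show "chart_inv c -` V \<inter> space (restrict_space (lborel_Cn n) (chart_image c))
      \<in> sets (restrict_space (lborel_Cn n) (chart_image c))"
    using openin_imp_sets_restrict_Cn[OF D(3) openin_chart_image[OF c V]] by auto
qed

definition chart_density :: "nat \<Rightarrow> 'a base_metric \<Rightarrow> 'a chart \<Rightarrow> 'a \<Rightarrow> real" where
  "chart_density n g c x = Re (Determinant.det (gram n g c x))"

lemma det_gram:
  assumes g: "hermitian_metric X n W g" and c: "c \<in> charts X n W" and x: "x \<in> fst c"
  shows "Determinant.det (gram n g c x) = complex_of_real (chart_density n g c x)"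
    and "0 < chart_density n g c x"
proof -
  have "hermitian_pos_def n (g c x)" using g c x by (simp add: hermitian_metric_def)
  note p = hermitian_pos_def_det_pos[OF this]
  show "Determinant.det (gram n g c x) = complex_of_real (chart_density n g c x)"
    and "0 < chart_density n g c x"
    using p unfolding gram_def chart_density_def by (simp_all add: complex_eq_iff)
qed

text \<open>
  The factor in front of \<open>det g\<close> is the squared modulus of the Jacobian determinant, written as
  a product of two determinants.  It does not involve the metric, so it cancels when two metrics are
  compared.
\<close>

lemma det_gram_change_chart:
  assumes g: "hermitian_metric X n W g" and c: "c \<in> charts X n W" "c' \<in> charts X n W"
    and x: "x \<in> fst c" "x \<in> fst c'"
  shows "Determinant.det (gram n g c' x)
    = Determinant.det (mat n n (\<lambda>(i, j). jac c c' x j i)) * Determinant.det (mat n n (\<lambda>(i, j). cnj (jac c c' x i j)))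
        * Determinant.det (gram n g c x)"
proof -
  let ?A = "mat n n (\<lambda>(i, j). jac c c' x j i)" and ?B = "mat n n (\<lambda>(i, j). cnj (jac c c' x i j))"
  have "gram n g c' x = ?A * (gram n g c x * ?B)"
  proof (rule eq_matI)
    fix i j assume "i < dim_row (?A * (gram n g c x * ?B))" "j < dim_col (?A * (gram n g c x * ?B))"
    then have ij: "i < n" "j < n" by (auto simp: gram_def)
    have "x \<in> fst c \<inter> fst c'" using x by simp
    then have "g c' x i j = (\<Sum>k<n. \<Sum>l<n. jac c c' x k i * cnj (jac c c' x l j) * g c x k l)"
      using g c ij unfolding hermitian_metric_def by blast
    then show "gram n g c' x $$ (i, j) = (?A * (gram n g c x * ?B)) $$ (i, j)"
      using ij by (simp add: gram_def scalar_prod_def sum_distrib_left atLeast0LessThan mult_ac)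
  qed (auto simp: gram_def)
  also have "Determinant.det \<dots> = Determinant.det ?A * (Determinant.det (gram n g c x) * Determinant.det ?B)"
    by (subst det_mult[of _ n]; (subst det_mult[of _ n])?) (auto simp: gram_def)
  finally show ?thesis by (simp add: mult_ac)
qed

lemma chart_density_ratio_change_chart:
  assumes g: "hermitian_metric X n W g1" "hermitian_metric X n W g2"
    and c: "c \<in> charts X n W" "c' \<in> charts X n W" and x: "x \<in> fst c" "x \<in> fst c'"
  shows "chart_density n g2 c' x / chart_density n g1 c' x = chart_density n g2 c x / chart_density n g1 c x"
proof -
  let ?q = "Determinant.det (mat n n (\<lambda>(i, j). jac c c' x j i)) * Determinant.det (mat n n (\<lambda>(i, j). cnj (jac c c' x i j)))"
  have e: "complex_of_real (chart_density n g c' x) = ?q * complex_of_real (chart_density n g c x)"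
    if "hermitian_metric X n W g" for g
    using det_gram_change_chart[OF that c x] det_gram(1)[OF that c(1) x(1)] det_gram(1)[OF that c(2) x(2)]
    by simp
  have "?q \<noteq> 0"
    using e[OF g(1)] det_gram(2)[OF g(1) c(2) x(2)] by (metis mult_zero_left of_real_eq_0_iff order_less_irrefl)
  then have "complex_of_real (chart_density n g2 c' x / chart_density n g1 c' x)
      = complex_of_real (chart_density n g2 c x / chart_density n g1 c x)"
    unfolding of_real_divide e[OF g(1)] e[OF g(2)] by simp
  then show ?thesis by (simp only: of_real_eq_iff)
qed

text \<open>
  Continuity is what makes the chart densities measurable, and through
  \<open>continuous_map_chart_density\<close> it also makes the ratio of two densities measurable
  on a union of possibly uncountably many charts.
\<close>

lemma continuous_map_chart_density_inv:
  assumes g: "hermitian_metric X n W g" and c: "c \<in> charts X n W"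
  shows "continuous_map (subtopology (Cn n) (chart_image c)) euclidean (\<lambda>z. chart_density n g c (chart_inv c z))"
proof -
  have coeff: "continuous_map (subtopology (Cn n) (chart_image c)) euclidean (\<lambda>z. g c (chart_inv c z) j k)"
    if "j < n" "k < n" for j k
  proof -
    have "smooth_Cn n (chart_image c) (\<lambda>z. g c (chart_inv c z) j k)"
      using g c that by (simp add: hermitian_metric_def)
    then have "Ck_Cn 0 n (chart_image c) (\<lambda>z. g c (chart_inv c z) j k)"
      unfolding smooth_Cn_def by blast
    then show ?thesis by simp
  qed
  have expand: "chart_density n g c x = Re (\<Sum>p | p permutes {0..<n}. signof p * (\<Prod>i = 0..<n. g c x i (p i)))" for x
    unfolding chart_density_def gram_def det_def'[OF mat_carrier]
    by (intro arg_cong[where f=Re] sum.cong prod.cong refl arg_cong2[where f="(*)"])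
       (auto simp: permutes_in_image)
  show ?thesis
    unfolding expand continuous_map_atin limitin_canonical_iff
    using coeff unfolding continuous_map_atin limitin_canonical_iff
    by (auto intro!: tendsto_intros simp: permutes_in_image)
qed

lemma continuous_map_chart_density:
  assumes g: "hermitian_metric X n W g" and c: "c \<in> charts X n W"
  shows "continuous_map (subtopology (top_of X) (fst c)) euclidean (chart_density n g c)"
proof (rule continuous_map_eq)
  show "continuous_map (subtopology (top_of X) (fst c)) euclidean
      ((\<lambda>z. chart_density n g c (chart_inv c z)) \<circ> snd c)"
    using homeomorphic_imp_continuous_map[OF chartsD(4)[OF c]] continuous_map_chart_density_inv[OF g c]
    by (rule continuous_map_compose)
qed (use chartsD(5)[OF c] in auto)

text \<open>
  The quotient of the two volume forms.  At a point that lies in no \<open>n\<close>-dimensional chart it is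
  set to \<open>0\<close>: such points carry no volume, and with this value the comparison of the norms of a
  form is trivial there.
\<close>

definition volume_ratio ::
    "'a complex_space \<Rightarrow> nat \<Rightarrow> 'a set \<Rightarrow> 'a base_metric \<Rightarrow> 'a base_metric \<Rightarrow> 'a \<Rightarrow> real" where
  "volume_ratio X n W g1 g2 x =
     (if \<exists>c. c \<in> charts X n W \<and> x \<in> fst c
      then let c = SOME c. c \<in> charts X n W \<and> x \<in> fst c in chart_density n g2 c x / chart_density n g1 c x
      else 0)"

lemma volume_ratio_in_chart:
  assumes g: "hermitian_metric X n W g1" "hermitian_metric X n W g2"
    and c: "c \<in> charts X n W" "x \<in> fst c"
  shows "volume_ratio X n W g1 g2 x = chart_density n g2 c x / chart_density n g1 c x"
proof -
  have ex: "\<exists>c. c \<in> charts X n W \<and> x \<in> fst c" using c by blast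
  note s = someI_ex[OF ex]
  show ?thesis
    unfolding volume_ratio_def Let_def using ex chart_density_ratio_change_chart[OF g c(1) _ c(2)] s by auto
qed

text \<open>
  The union of all charts is open and the ratio is continuous on it, so its preimages of open
  sets are open there; off this union the ratio vanishes.
\<close>

lemma volume_ratio_measurable:
  assumes g: "hermitian_metric X n W g1" "hermitian_metric X n W g2"
  shows "volume_ratio X n W g1 g2 \<in> borel_measurable (volume_algebra X W)"
proof (rule borel_measurableI)
  fix S :: "real set" assume S: "open S"
  let ?r = "volume_ratio X n W g1 g2" and ?O = "\<Union>c\<in>charts X n W. fst c"
  have "{x\<in>?O. ?r x \<in> S} = (\<Union>c\<in>charts X n W. {x\<in>fst c. ?r x \<in> S})" by auto
  moreover have "openin (top_of X) {x\<in>fst c. ?r x \<in> S}" if c: "c \<in> charts X n W" for c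
  proof -
    have "continuous_map (subtopology (top_of X) (fst c)) euclidean
        (\<lambda>x. chart_density n g2 c x / chart_density n g1 c x)"
      using continuous_map_chart_density[OF g(1) c] continuous_map_chart_density[OF g(2) c]
        det_gram(2)[OF g(1) c]
      by (intro continuous_map_real_divide) force+
    then have "continuous_map (subtopology (top_of X) (fst c)) euclidean ?r"
      by (rule continuous_map_eq) (simp add: volume_ratio_in_chart[OF g c])
    then have "openin (subtopology (top_of X) (fst c)) {x\<in>fst c. ?r x \<in> S}"
      using S openin_subset[OF chartsD(1)[OF c]] unfolding continuous_map_def by (auto simp: Int_absorb1)
    then show ?thesis using chartsD(1)[OF c] openin_trans_full by blast
  qed
  ultimately have open_r: "openin (top_of X) {x\<in>?O. ?r x \<in> S}" by auto
  have O: "openin (top_of X) ?O" "?O \<subseteq> W" using chartsD(1,2) by (blast intro: openin_Union)+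
  have zero: "?r x = 0" if "x \<notin> ?O" for x
    using that by (auto simp: volume_ratio_def)
  have "?r -` S \<inter> space (volume_algebra X W) = {x\<in>?O. ?r x \<in> S} \<union> (if 0 \<in> S then W - ?O else {})"
    (is "?L = ?R")
  proof (rule Set.set_eqI)
    fix x show "x \<in> ?L \<longleftrightarrow> x \<in> ?R"
      unfolding space_volume_algebra using O(2) zero[of x] by (cases "x \<in> ?O") auto
  qed
  moreover have "{x\<in>?O. ?r x \<in> S} \<in> sets (volume_algebra X W)"
    using open_r O(2) by (intro openin_imp_sets_volume_algebra) auto
  moreover have "W - ?O \<in> sets (volume_algebra X W)"
    using openin_imp_sets_volume_algebra[OF O] sets.compl_sets space_volume_algebra by metis
  ultimately show "?r -` S \<inter> space (volume_algebra X W) \<in> sets (volume_algebra X W)" by simp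
qed

text \<open>
  On a single chart, multiplying the volume of \<open>g1\<close> by the ratio gives that of \<open>g2\<close>.
  The measure \<open>M\<close> stands for the glued volume of \<open>g1\<close>.
\<close>

lemma chart_volume_le_density:
  assumes g: "hermitian_metric X n W g1" "hermitian_metric X n W g2" and c: "c \<in> charts X n W"
    and M: "sets M = sets (volume_algebra X W)" "chart_volume X n W g1 c \<le> M"
  shows "chart_volume X n W g2 c \<le> density M (\<lambda>x. ennreal (volume_ratio X n W g1 g2 x))"
proof -
  let ?r = "\<lambda>x. ennreal (volume_ratio X n W g1 g2 x)"
  let ?L = "restrict_space (lborel_Cn n) (chart_image c)"
  let ?d = "\<lambda>g z. ennreal (chart_density n g c (chart_inv c z))"
  have vol: "chart_volume X n W g c = distr (density ?L (?d g)) (volume_algebra X W) (chart_inv c)" for g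
    by (simp add: chart_volume_def volume_algebra_def chart_density_def)
  have inv: "chart_inv c \<in> density ?L (?d g) \<rightarrow>\<^sub>M volume_algebra X W" for g
    using chart_inv_measurable[OF c] by simp
  have d: "?d g \<in> borel_measurable ?L" if "hermitian_metric X n W g" for g
    using continuous_map_imp_measurable_Cn[OF chartsD(3)[OF c] continuous_map_chart_density_inv[OF that c]]
    by measurable
  have r: "?r \<in> borel_measurable (volume_algebra X W)"
    using volume_ratio_measurable[OF g] by measurable
  have dr: "?d g1 z * ?r (chart_inv c z) = ?d g2 z" if z: "z \<in> chart_image c" for z
  proof -
    have x: "chart_inv c z \<in> fst c" using z by (auto simp: chartsD(5)[OF c])
    show ?thesis
      using det_gram(2)[OF g(1) c x] det_gram(2)[OF g(2) c x]
      by (simp add: volume_ratio_in_chart[OF g c x] flip: ennreal_mult)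
  qed
  have "emeasure (chart_volume X n W g2 c) A \<le> emeasure (density M ?r) A"
    if A: "A \<in> sets (volume_algebra X W)" for A
  proof -
    have ind: "indicator A \<in> borel_measurable (volume_algebra X W)" using A by simp
    have rind: "(\<lambda>x. ?r x * indicator A x) \<in> borel_measurable (volume_algebra X W)"
      using r ind by (rule borel_measurable_times_ennreal)
    have "emeasure (chart_volume X n W g2 c) A = (\<integral>\<^sup>+x. indicator A x \<partial>chart_volume X n W g2 c)"
      using A by (simp add: sets_chart_volume)
    also have "\<dots> = (\<integral>\<^sup>+z. indicator A (chart_inv c z) \<partial>density ?L (?d g2))"
      unfolding vol by (rule nn_integral_distr) (use inv ind in auto)
    also have "\<dots> = (\<integral>\<^sup>+z. ?d g2 z * indicator A (chart_inv c z) \<partial>?L)"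
      using measurable_compose[OF chart_inv_measurable[OF c] ind]
      by (intro nn_integral_density d g)
    also have "\<dots> = (\<integral>\<^sup>+z. ?d g1 z * (?r (chart_inv c z) * indicator A (chart_inv c z)) \<partial>?L)"
      by (intro nn_integral_cong) (simp add: space_restrict_Cn[OF chartsD(3)[OF c]] dr mult.assoc[symmetric])
    also have "\<dots> = (\<integral>\<^sup>+z. ?r (chart_inv c z) * indicator A (chart_inv c z) \<partial>density ?L (?d g1))"
      using measurable_compose[OF chart_inv_measurable[OF c] rind]
      by (intro nn_integral_density[symmetric] d g)
    also have "\<dots> = (\<integral>\<^sup>+x. ?r x * indicator A x \<partial>chart_volume X n W g1 c)"
      unfolding vol by (rule nn_integral_distr[symmetric]) (use inv rind in auto)
    also have "\<dots> \<le> (\<integral>\<^sup>+x. ?r x * indicator A x \<partial>M)"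
      using M by (intro nn_integral_mono_measure) (auto simp: sets_chart_volume)
    also have "\<dots> = emeasure (density M ?r) A"
      using r A M(1) by (subst emeasure_density) (auto cong: measurable_cong_sets)
    finally show ?thesis .
  qed
  then have "emeasure (chart_volume X n W g2 c) A \<le> emeasure (density M ?r) A" for A
    by (cases "A \<in> sets (volume_algebra X W)") (simp_all add: emeasure_notin_sets sets_chart_volume)
  moreover have "sets (chart_volume X n W g2 c) = sets (density M ?r)"
    using M(1) by (simp add: sets_chart_volume)
  ultimately show ?thesis
    using sets_eq_imp_space_eq[of "chart_volume X n W g2 c" "density M ?r"] by (simp add: le_measure_iff le_fun_def)
qed

text \<open>
  The volume of \<open>g2\<close> is a supremum over charts, hence the least upper bound of the chart
  volumes; by \<open>chart_volume_le_density\<close> it is at most the volume of \<open>g1\<close> times the ratio.  As the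
  integral of an arbitrary function is the same for a measure and its completion, the null sets added
  by the completion cause no difficulty.
\<close>

lemma nn_integral_volume_le:
  assumes g: "hermitian_metric X n W g1" "hermitian_metric X n W g2"
  shows "(\<integral>\<^sup>+x. f x \<partial>volume X n W g2)
    \<le> (\<integral>\<^sup>+x. ennreal (volume_ratio X n W g1 g2 x) * f x \<partial>volume X n W g1)"
proof (cases "charts X n W = {}")
  case True
  then have "nn_integral (volume X n W g2) f = 0"
    by (simp add: volume_def nn_integral_completion nn_integral_empty)
  then show ?thesis by simp
next
  case False
  let ?r = "\<lambda>x. ennreal (volume_ratio X n W g1 g2 x)"
  let ?M = "\<lambda>g. SUP c\<in>charts X n W. chart_volume X n W g c"
  have sets: "sets (?M g) = sets (volume_algebra X W)" for g
    using False by (intro sets_SUP) (simp_all add: sets_chart_volume)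
  have le: "?M g2 \<le> density (?M g1) ?r"
  proof (rule SUP_least)
    fix c assume c: "c \<in> charts X n W"
    then have "chart_volume X n W g1 c \<le> ?M g1" by (rule SUP_upper)
    then show "chart_volume X n W g2 c \<le> density (?M g1) ?r"
      by (rule chart_volume_le_density[OF g c sets])
  qed
  have r: "?r \<in> borel_measurable (?M g1)"
    unfolding measurable_cong_sets[OF sets refl] using volume_ratio_measurable[OF g] by measurable
  have "(\<integral>\<^sup>+x. f x \<partial>?M g2) \<le> (\<integral>\<^sup>+x. f x \<partial>density (?M g1) ?r)"
    using le by (intro nn_integral_mono_measure) (simp_all only: sets sets_density)
  also have "\<dots> \<le> (\<integral>\<^sup>+x. ?r x * f x \<partial>?M g1)"
    by (rule nn_integral_density_le[OF r])
  finally show ?thesis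
    by (simp add: volume_def nn_integral_completion)
qed

section \<open>Norms of forms of top degree\<close>

lemma multi_idx_0: "multi_idx n 0 = {[]}"
  by (auto simp: multi_idx_def)

lemma sum_swap_pairs:
  "(\<Sum>i\<in>A. \<Sum>j\<in>B. \<Sum>k\<in>C. \<Sum>l\<in>D. f i j k l) = (\<Sum>k\<in>C. \<Sum>l\<in>D. \<Sum>i\<in>A. \<Sum>j\<in>B. f i j k l)"
proof -
  have "(\<Sum>i\<in>A. \<Sum>j\<in>B. \<Sum>k\<in>C. \<Sum>l\<in>D. f i j k l)
      = (\<Sum>(i, j)\<in>A \<times> B. \<Sum>(k, l)\<in>C \<times> D. f i j k l)"
    by (simp only: sum.cartesian_product[of _ D C] sum.cartesian_product[of _ B A])
  also have "\<dots> = (\<Sum>(k, l)\<in>C \<times> D. \<Sum>(i, j)\<in>A \<times> B. f i j k l)"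
    unfolding split_def by (rule sum.swap)
  also have "\<dots> = (\<Sum>k\<in>C. \<Sum>l\<in>D. \<Sum>i\<in>A. \<Sum>j\<in>B. f i j k l)"
    by (simp only: sum.cartesian_product[of _ D C] sum.cartesian_product[of _ B A])
  finally show ?thesis .
qed

text \<open>
  Writing a form of top degree as \<open>v dz\<^sub>1 \<and> \<dots> \<and> dz\<^sub>n\<close>, the metric of the base contributes exactly
  the factor \<open>1 / det g\<close>.  The quotient by \<open>n!\<close> in the norm compensates for the summation over all
  orderings of the indices.
\<close>

lemma chart_norm_sq_top_form:
  assumes form: "bundle_form X n E n 0 V \<alpha>" and cV: "c \<in> charts X n V"
    and H: "smooth_bundle_metric X n W E (smooth_part h)"
    and g: "hermitian_metric X n W g" and cW: "c \<in> charts X n W"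
    and \<tau>: "\<tau> \<in> trivs E" and x: "x \<in> fst c" "x \<in> fst \<tau>"
  defines "v \<equiv> \<alpha> c x [0..<n] []"
  shows "chart_norm_sq n E h g n 0 \<alpha> c x
      = exp_neg (weight h x) * ennreal (Re (smooth_part h v v) / chart_density n g c x)"
    and "0 \<le> Re (smooth_part h v v)"
proof -
  define A where "A k I = snd \<tau> (\<alpha> c x I []) k" for k I
  define G where "G = the (mat_inverse (gram n g c x))"
  let ?S = "multi_idx n n"
  let ?P = "\<lambda>I I'. \<Prod>a<n. G $$ (I' ! a, I ! a)"
  have "\<exists>m. \<forall>y\<in>fst \<tau>. hermitian_pos_def (rank E) (m y) \<and>
      (\<forall>u\<in>fibre E y. \<forall>w\<in>fibre E y.
        smooth_part h u w = (\<Sum>k<rank E. \<Sum>l<rank E. m y k l * snd \<tau> u k * cnj (snd \<tau> w l)))"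
    using bspec[OF H[unfolded smooth_bundle_metric_def] \<tau>] by (rule ex_forward) (rule conjunct2)
  then obtain m where m: "\<forall>y\<in>fst \<tau>. hermitian_pos_def (rank E) (m y) \<and>
      (\<forall>u\<in>fibre E y. \<forall>w\<in>fibre E y.
        smooth_part h u w = (\<Sum>k<rank E. \<Sum>l<rank E. m y k l * snd \<tau> u k * cnj (snd \<tau> w l)))"
    by (rule exE)
  note m_at = bspec[OF m x(2)]
  have m: "hermitian_pos_def (rank E) (m x)" using m_at by (rule conjunct1)
  have Hm: "smooth_part h u w = (\<Sum>k<rank E. \<Sum>l<rank E. m x k l * snd \<tau> u k * cnj (snd \<tau> w l))"
    if "u \<in> fibre E x" "w \<in> fibre E x" for u w
    using m_at that by simp
  have fib: "\<alpha> c x I [] \<in> fibre E x" if "I \<in> ?S" for I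
    using form[unfolded bundle_form_def multi_idx_0, THEN conjunct1] cV x(1) that by simp
  have id: "[0..<n] \<in> ?S" by (auto simp: multi_idx_def)
  have HA: "smooth_part h (\<alpha> c x I []) (\<alpha> c x I' [])
      = (\<Sum>k<rank E. \<Sum>l<rank E. m x k l * A k I * cnj (A l I'))" if "I \<in> ?S" "I' \<in> ?S" for I I'
    unfolding A_def using that by (intro Hm fib)
  have alt: "A k (swap_idx a b I) = - A k I" if "k < rank E" "I \<in> ?S" "a < b" "b < n" for k a b I
  proof -
    have "x \<in> fst c \<inter> fst \<tau>" using x by simp
    then show ?thesis
      using form cV \<tau> that unfolding bundle_form_def A_def multi_idx_0 by blast
  qed
  note det = det_gram[OF g cW x(1)]
  have gram: "gram n g c x \<in> carrier_mat n n" by (simp add: gram_def)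
  have nz: "Determinant.det (gram n g c x) \<noteq> 0" using det by simp
  have G: "G \<in> carrier_mat n n" "Determinant.det G = 1 / complex_of_real (chart_density n g c x)"
    using det_mat_inverse[OF gram nz] det(1) unfolding G_def by simp_all
  have pair: "(\<Sum>I\<in>?S. \<Sum>I'\<in>?S. ?P I I' * (A k I * cnj (A l I')))
      = fact n * Determinant.det G * (A k [0..<n] * cnj (A l [0..<n]))"
    if "k < rank E" "l < rank E" for k l
    using that alt G(1) by (intro alternating_pairing_eq_det[where B="\<lambda>I. cnj (A l I)"]) auto
  have "(\<Sum>I\<in>?S. \<Sum>I'\<in>?S. ?P I I' * smooth_part h (\<alpha> c x I []) (\<alpha> c x I' []))
      = (\<Sum>I\<in>?S. \<Sum>I'\<in>?S. \<Sum>k<rank E. \<Sum>l<rank E. m x k l * (?P I I' * (A k I * cnj (A l I'))))"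
    by (intro sum.cong refl) (simp add: HA sum_distrib_left mult_ac)
  also have "\<dots> = (\<Sum>k<rank E. \<Sum>l<rank E. m x k l * (\<Sum>I\<in>?S. \<Sum>I'\<in>?S. ?P I I' * (A k I * cnj (A l I'))))"
    by (subst sum_swap_pairs) (simp add: sum_distrib_left)
  also have "\<dots> = (\<Sum>k<rank E. \<Sum>l<rank E. m x k l * (fact n * Determinant.det G * (A k [0..<n] * cnj (A l [0..<n]))))"
    using pair by (intro sum.cong refl) simp
  also have "\<dots> = fact n * Determinant.det G * smooth_part h v v"
    unfolding v_def HA[OF id id] by (simp add: sum_distrib_left mult_ac)
  also have "\<dots> = complex_of_real (fact n / chart_density n g c x) * smooth_part h v v"
    using G(2) by simp
  finally have sum: "(\<Sum>I\<in>?S. \<Sum>I'\<in>?S. ?P I I' * smooth_part h (\<alpha> c x I []) (\<alpha> c x I' []))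
      = complex_of_real (fact n / chart_density n g c x) * smooth_part h v v" .
  have "Re (\<Sum>I\<in>?S. \<Sum>I'\<in>?S. ?P I I' * smooth_part h (\<alpha> c x I []) (\<alpha> c x I' [])) / fact n
      = Re (smooth_part h v v) / chart_density n g c x"
    unfolding sum by simp
  then show "chart_norm_sq n E h g n 0 \<alpha> c x
      = exp_neg (weight h x) * ennreal (Re (smooth_part h v v) / chart_density n g c x)"
    unfolding chart_norm_sq_def Let_def multi_idx_0 G_def by simp
  show "0 \<le> Re (smooth_part h v v)"
  proof (cases "\<exists>k<rank E. A k [0..<n] \<noteq> 0")
    case True
    then show ?thesis
      using m unfolding v_def HA[OF id id] hermitian_pos_def_def by (meson less_imp_le)
  next
    case False
    then show ?thesis unfolding v_def HA[OF id id] by simp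
  qed
qed

text \<open>
  Norms are computed in charts inside the domain of the section, volumes in all charts of the
  Zariski open set.  Restricting charts shows that a point of the domain covered by the latter is
  also covered by the former.
\<close>

lemma chart_restrict_open:
  assumes c: "c \<in> charts X n W" and V: "openin (top_of X) V"
  shows "(fst c \<inter> V, snd c) \<in> charts X n (V \<inter> W)"
proof -
  note D = chartsD[OF c]
  let ?U = "fst c \<inter> V"
  have U: "openin (top_of X) ?U" using D(1) V by (rule openin_Int)
  have im: "openin (Cn n) (snd c ` ?U)" using U by (intro openin_chart_image[OF c]) auto
  have "homeomorphic_map (subtopology (subtopology (top_of X) (fst c)) ?U)
      (subtopology (subtopology (Cn n) (chart_image c)) (snd c ` ?U)) (snd c)"
    using openin_subset[OF D(1)] openin_subset[OF D(3)]
    by (intro homeomorphic_map_subtopologies[OF D(4)]) auto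
  moreover have "fst c \<inter> ?U = ?U" "chart_image c \<inter> snd c ` ?U = snd c ` ?U" by auto
  ultimately have hom: "homeomorphic_map (subtopology (top_of X) ?U) (subtopology (Cn n) (snd c ` ?U)) (snd c)"
    by (simp only: subtopology_subtopology)
  have "\<forall>V f. openin (top_of X) V \<and> V \<subseteq> fst c \<longrightarrow>
        (f \<in> str_sheaf X V \<longleftrightarrow>
           (\<forall>x\<in>V. \<exists>W g. holomorphic_Cn n W g \<and> snd c x \<in> W \<and> (\<forall>y\<in>V. snd c y \<in> W \<longrightarrow> f y = g (snd c y))))"
    using c unfolding charts_def coord_chart_def model_chart_def by (simp add: split_def)
  then have "model_chart X n (snd c ` ?U) (?U, snd c)"
    unfolding model_chart_def using U hom openin_subset[OF im] by auto
  then show ?thesis using im D(2) by (auto simp: charts_def coord_chart_def)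
qed

text \<open>
  The factor \<open>det g2\<close> in the ratio cancels the \<open>1 / det g2\<close> in the norm: the product of norm
  and volume form is independent of the metric.  Equality may fail only at points outside all charts,
  where the left-hand side is zero.
\<close>

lemma volume_ratio_norm_sq:
  assumes form: "bundle_form X n E n 0 (U \<inter> W) \<alpha>" and U: "openin (top_of X) U"
    and E: "holomorphic_vector_bundle X W E" and H: "smooth_bundle_metric X n W E (smooth_part h)"
    and g: "hermitian_metric X n W g1" "hermitian_metric X n W g2"
    and x: "x \<in> U \<inter> W"
  shows "ennreal (volume_ratio X n W g1 g2 x) * norm_sq X n (U \<inter> W) E h g2 n 0 \<alpha> x
    \<le> norm_sq X n (U \<inter> W) E h g1 n 0 \<alpha> x"
proof (cases "\<exists>c\<in>charts X n W. x \<in> fst c")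
  case False
  then have "volume_ratio X n W g1 g2 x = 0" by (auto simp: volume_ratio_def)
  then show ?thesis by simp
next
  case True
  then have ex: "\<exists>c. c \<in> charts X n (U \<inter> W) \<and> x \<in> fst c"
    using chart_restrict_open[OF _ U] x by fastforce
  define c where "c = (SOME c. c \<in> charts X n (U \<inter> W) \<and> x \<in> fst c)"
  have c: "c \<in> charts X n (U \<inter> W)" "x \<in> fst c" using someI_ex[OF ex] unfolding c_def by auto
  then have cW: "c \<in> charts X n W" by (auto simp: charts_def)
  obtain \<tau> where \<tau>: "\<tau> \<in> trivs E" "x \<in> fst \<tau>"
    using E x unfolding holomorphic_vector_bundle_def by blast
  let ?q = "Re (smooth_part h (\<alpha> c x [0..<n] []) (\<alpha> c x [0..<n] []))"
  have norm: "norm_sq X n (U \<inter> W) E h g n 0 \<alpha> x = exp_neg (weight h x) * ennreal (?q / chart_density n g c x)"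
    if "hermitian_metric X n W g" for g
    unfolding norm_sq_def c_def[symmetric]
    by (rule chart_norm_sq_top_form(1)[OF form c(1) H that cW \<tau>(1) c(2) \<tau>(2)])
  have q: "0 \<le> ?q" by (rule chart_norm_sq_top_form(2)[OF form c(1) H g(1) cW \<tau>(1) c(2) \<tau>(2)])
  have pos: "0 < chart_density n g1 c x" "0 < chart_density n g2 c x"
    using det_gram(2)[OF _ cW c(2)] g by auto
  have "ennreal (volume_ratio X n W g1 g2 x) * ennreal (?q / chart_density n g2 c x)
      = ennreal (?q / chart_density n g1 c x)"
    unfolding volume_ratio_in_chart[OF g cW c(2)] using q pos by (subst ennreal_mult[symmetric]) auto
  then show ?thesis
    unfolding norm[OF g(1)] norm[OF g(2)] by (metis mult.left_commute order_refl)
qed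

section \<open>Independence of the base metric\<close>

text \<open>
  The zero vector is a definite description, so its existence and uniqueness have to be shown.
  They follow from one trivialisation at the point, since the transition functions are linear.
\<close>

lemma fibre_zero_coords:
  assumes E: "holomorphic_vector_bundle X W E" and x: "x \<in> W"
  shows "fibre_zero E x \<in> fibre E x"
    and "\<tau> \<in> trivs E \<Longrightarrow> x \<in> fst \<tau> \<Longrightarrow> k < rank E \<Longrightarrow> snd \<tau> (fibre_zero E x) k = 0"
proof -
  let ?Z = "\<lambda>v. v \<in> fibre E x \<and> (\<forall>\<tau>\<in>trivs E. x \<in> fst \<tau> \<longrightarrow> (\<forall>k<rank E. snd \<tau> v k = 0))"
  obtain \<sigma> where \<sigma>: "\<sigma> \<in> trivs E" "x \<in> fst \<sigma>"
    using E x unfolding holomorphic_vector_bundle_def by blast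
  have bij: "bij_betw (snd \<sigma>) (fibre E x) (topspace (Cn (rank E)))"
    using E \<sigma> unfolding holomorphic_vector_bundle_def by blast
  have top: "topspace (Cn (rank E)) = PiE {..<rank E} (\<lambda>_. UNIV)" by (simp add: Cn_def)
  have "(\<lambda>k\<in>{..<rank E}. 0) \<in> topspace (Cn (rank E))" unfolding top by auto
  then obtain z where z: "z \<in> fibre E x" "snd \<sigma> z = (\<lambda>k\<in>{..<rank E}. 0)"
    using bij unfolding bij_betw_def by (metis imageE)
  have "snd \<tau> z k = 0" if \<tau>: "\<tau> \<in> trivs E" "x \<in> fst \<tau>" and k: "k < rank E" for \<tau> k
  proof -
    obtain a where "\<forall>k<rank E. \<forall>y\<in>fst \<sigma> \<inter> fst \<tau>. \<forall>v\<in>fibre E y. snd \<tau> v k = (\<Sum>l<rank E. a k l y * snd \<sigma> v l)"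
      using E \<sigma>(1) \<tau>(1) unfolding holomorphic_vector_bundle_def by meson
    then have "snd \<tau> z k = (\<Sum>l<rank E. a k l x * snd \<sigma> z l)" using \<sigma>(2) \<tau>(2) z(1) k by blast
    then show ?thesis using z(2) by simp
  qed
  then have Z: "?Z z" using z(1) by blast
  have "w = z" if "?Z w" for w
  proof -
    have "snd \<sigma> w \<in> PiE {..<rank E} (\<lambda>_. UNIV)" "snd \<sigma> z \<in> PiE {..<rank E} (\<lambda>_. UNIV)"
      using bij that z(1) unfolding top bij_betw_def by auto
    then have "snd \<sigma> w = snd \<sigma> z" using that \<sigma> z(2) by (intro PiE_ext) auto
    then show ?thesis using bij that z(1) unfolding bij_betw_def inj_on_def by blast
  qed
  then have "?Z (fibre_zero E x)" unfolding fibre_zero_def using Z by (rule theI[rotated])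
  then show "fibre_zero E x \<in> fibre E x"
    and "\<tau> \<in> trivs E \<Longrightarrow> x \<in> fst \<tau> \<Longrightarrow> k < rank E \<Longrightarrow> snd \<tau> (fibre_zero E x) k = 0"
    by blast+
qed

lemma norm_sq_zero_form:
  assumes E: "holomorphic_vector_bundle X W E" and H: "smooth_bundle_metric X n W E (smooth_part h)"
    and x: "x \<in> W"
  shows "norm_sq X n V E h g p q (zero_form E) x = 0"
proof -
  obtain \<tau> where \<tau>: "\<tau> \<in> trivs E" "x \<in> fst \<tau>"
    using E x unfolding holomorphic_vector_bundle_def by blast
  obtain m where "\<And>u w. u \<in> fibre E x \<Longrightarrow> w \<in> fibre E x \<Longrightarrow>
      smooth_part h u w = (\<Sum>k<rank E. \<Sum>l<rank E. m x k l * snd \<tau> u k * cnj (snd \<tau> w l))"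
    using H \<tau> unfolding smooth_bundle_metric_def by blast
  then have "smooth_part h (fibre_zero E x) (fibre_zero E x) = 0"
    using fibre_zero_coords[OF E x] \<tau> by simp
  then show ?thesis unfolding norm_sq_def chart_norm_sq_def zero_form_def by simp
qed

text \<open>
  The neighbourhood \<open>V\<close> is the same for both metrics, although the ratio of the metrics need not be
  bounded near points of \<open>X\<close> outside \<open>W\<close>.
\<close>

lemma square_integrable_top_form_change_metric:
  assumes form: "bundle_form X n E n 0 (U \<inter> W) \<alpha>" and U: "openin (top_of X) U" and V: "V \<subseteq> U"
    and E: "holomorphic_vector_bundle X W E" and H: "smooth_bundle_metric X n W E (smooth_part h)"
    and g: "hermitian_metric X n W g1" "hermitian_metric X n W g2"
    and int: "square_integrable_form X n W E h g1 n 0 U V \<alpha>"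
  shows "square_integrable_form X n W E h g2 n 0 U V \<alpha>"
proof -
  let ?r = "\<lambda>x. ennreal (volume_ratio X n W g1 g2 x)"
  let ?N = "\<lambda>g x. norm_sq X n (U \<inter> W) E h g n 0 \<alpha> x"
  have "(\<integral>\<^sup>+x\<in>V \<inter> W. ?N g2 x \<partial>volume X n W g2)
      \<le> (\<integral>\<^sup>+x. ?r x * (?N g2 x * indicator (V \<inter> W) x) \<partial>volume X n W g1)"
    by (rule nn_integral_volume_le[OF g])
  also have "\<dots> \<le> (\<integral>\<^sup>+x\<in>V \<inter> W. ?N g1 x \<partial>volume X n W g1)"
    using volume_ratio_norm_sq[OF form U E H g] V
    by (intro nn_integral_mono) (auto simp: indicator_def)
  finally show ?thesis using int unfolding square_integrable_form_def by (rule le_less_trans)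
qed

text \<open>
  A section of \<open>S\<close> satisfies \<open>\<partial>\<bar>\<alpha> = 0\<close>, a condition free of the metric, and the zero form is square
  integrable for every metric.  It therefore serves as the derivative required for membership in
  the larger sheaf \<open>D\<close> for \<open>g2\<close>, and only the integrability of \<open>\<alpha>\<close> itself is to be transferred.
\<close>

lemma S_sheaf_mono_metric:
  assumes U: "openin (top_of X) U"
    and E: "holomorphic_vector_bundle X W E" and H: "smooth_bundle_metric X n W E (smooth_part h)"
    and g: "hermitian_metric X n W g1" "hermitian_metric X n W g2"
  shows "S_sheaf X n W E h g1 U \<subseteq> S_sheaf X n W E h g2 U"
proof
  fix \<alpha> assume "\<alpha> \<in> S_sheaf X n W E h g1 U"
  then have \<alpha>: "measurable_form X n E n 0 (U \<inter> W) \<alpha>"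
    and hol: "weak_dbar X n E n 0 (U \<inter> W) \<alpha> (zero_form E)"
    and int: "\<forall>x\<in>U. \<exists>V. openin (top_of X) V \<and> x \<in> V \<and> V \<subseteq> U \<and> square_integrable_form X n W E h g1 n 0 U V \<alpha>"
    unfolding S_sheaf_def D_sheaf_def by blast+
  have form: "bundle_form X n E n 0 (U \<inter> W) \<alpha>" using \<alpha> by (simp add: measurable_form_def)
  have zero: "square_integrable_form X n W E h g2 n (Suc 0) U V (zero_form E)" for V
  proof -
    have "(\<integral>\<^sup>+x\<in>V \<inter> W. norm_sq X n (U \<inter> W) E h g2 n (Suc 0) (zero_form E) x \<partial>volume X n W g2) = (\<integral>\<^sup>+x. 0 \<partial>volume X n W g2)"
      by (intro nn_integral_cong) (auto simp: norm_sq_zero_form[OF E H] indicator_def)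
    then show ?thesis by (simp add: square_integrable_form_def)
  qed
  have "\<forall>x\<in>U. \<exists>V. openin (top_of X) V \<and> x \<in> V \<and> V \<subseteq> U \<and> square_integrable_form X n W E h g2 n 0 U V \<alpha>
      \<and> square_integrable_form X n W E h g2 n (Suc 0) U V (zero_form E)"
    using int zero square_integrable_top_form_change_metric[OF form U _ E H g] by meson
  then show "\<alpha> \<in> S_sheaf X n W E h g2 U"
    unfolding S_sheaf_def D_sheaf_def using \<alpha> hol by blast
qed

theorem proposition4p2:
  fixes X :: "'a complex_space" and n :: nat and Xo :: "'a set"
    and E :: "('a, 'e) vbundle" and h :: "('a, 'e) singular_metric"
    and ds1 ds2 :: "'a base_metric" and U :: "'a set"
  assumes "reduced_complex_space X"
    and "irreducible_space X"
    and "paracompact_space (top_of X)"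
    and "countable_at_infinity (top_of X)"
    and "has_dim X n"
    and "Zariski_open X Xo"
    and "Xo \<subseteq> reg X"
    and "holomorphic_vector_bundle X Xo E"
    and "singular_hermitian_metric X n Xo E h"
    and "hermitian_metric X n Xo ds1"
    and "hermitian_metric X n Xo ds2"
    and "openin (top_of X) U"
  shows "S_sheaf X n Xo E h ds1 U = S_sheaf X n Xo E h ds2 U"
proof -
  have H: "smooth_bundle_metric X n Xo E (smooth_part h)"
    using assms(9) by (simp add: singular_hermitian_metric_def)
  show ?thesis
    using S_sheaf_mono_metric[OF assms(12) assms(8) H assms(10,11)]
      S_sheaf_mono_metric[OF assms(12) assms(8) H assms(11,10)] by (rule equalityI)
qed

end
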